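(* Let $(W,S)$ be a finite Coxeter system and $\theta:W\to W$ a group automorphism with $\theta^2=\mathrm{id}$ and $\theta(S)=S$. Any linear extension of $\mathrm{Wk}(\theta)$ is a shelling order for $\Delta_\theta$ (where each $w\in\mathfrak{I}(\theta)$ is identified with the facet $wC_\emptyset$). In particular, $\Delta_\theta$ is shellable.
   Context: $\mathfrak{I}(\theta)=\{w\in W\mid \theta(w)=w^{-1}\}$. For $s\in S$, $\underline{s}$ is a formal symbol; the free monoid on these symbols acts on the right on $W$ by $w\underline{s}=ws$ if $\theta(s)ws=w$, and $w\underline{s}=\theta(s)ws$ otherwise, with $w\underline{s}_1\cdots\underline{s}_k=(\cdots(w\underline{s}_1)\cdots)\underline{s}_k$; $\underline{s}_1\cdots\underline{s}_k$ alone means $e\underline{s}_1\cdots\underline{s}_k$, $e$ the identity. These are exactly the elements of $\mathfrak{I}(\theta)$; $\rho(w)$ is the minimal such $k$ for $w$. The weak order $\mathrm{Wk}(\theta)$ on $\mathfrak{I}(\theta)$: $v\preceq w$ iff there exist $s_1,\dots,s_k\in S$ with $v\underline{s}_1\cdots\underline{s}_k=w$ and $\rho(v)=\rho(w)-k$. Let $G_\theta$ be the edge-labelled graph on vertex set $\mathfrak{I}(\theta)$ with an edge labelled $s$ between $v$ and $w$ whenever $v\underline{s}=w$. For $J\subseteq S$ and $w\in\mathfrak{I}(\theta)$, $wC_J$ is the connected component containing $w$ of the subgraph of $G_\theta$ keeping only edges with labels in $J$ (as a labelled graph). $P_\theta=\{wC_J\}$ ordered by reverse inclusion of labelled subgraphs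 is the face poset of a pure Boolean cell complex $\Delta_\theta$ of dimension $|S|-1$ (cells $wC_J$ of dimension $|S|-|J|-1$, with $G_\theta$ the empty cell); its facets are the $wC_\emptyset$, $w\in\mathfrak{I}(\theta)$, and cell $g$ is contained in cell $h$ iff $h$ is a labelled subgraph of $g$. A shelling order of a pure Boolean cell complex is an ordering $F_0,\dots,F_t$ of its facets such that $F_i\cap(\bigcup_{\alpha<i}F_\alpha)$ is pure of codimension $1$ in $F_i$ for every $i\in\{1,\dots,t\}$. *)

theory Defs
  imports "HOL-Algebra.Generated_Groups"
begin

section \<open>Coxeter systems\<close>

text \<open>Group words are lists of signed letters: \<open>(s, True)\<close> stands for the generator \<open>s\<close> and
  \<open>(s, False)\<close> for its formal inverse.\<close>

type_synonym 'a gword = "('a \<times> bool) list"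

fun word_eval :: "('a, 'b) monoid_scheme \<Rightarrow> 'a gword \<Rightarrow> 'a" where
  "word_eval G [] = \<one>\<^bsub>G\<^esub>"
| "word_eval G ((s, b) # u) = (if b then s else inv\<^bsub>G\<^esub> s) \<otimes>\<^bsub>G\<^esub> word_eval G u"

text \<open>The congruence on words over \<open>S\<close> whose quotient is the group presented by generators \<open>S\<close>
  and relators \<open>R\<close>.\<close>

inductive pres_eq :: "'a set \<Rightarrow> 'a gword set \<Rightarrow> 'a gword \<Rightarrow> 'a gword \<Rightarrow> bool"
  for S :: "'a set" and R :: "'a gword set" where
  refl: "pres_eq S R u u"
| sym: "pres_eq S R u v \<Longrightarrow> pres_eq S R v u"
| trans: "pres_eq S R u v \<Longrightarrow> pres_eq S R v w \<Longrightarrow> pres_eq S R u w"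
| cong: "pres_eq S R u v \<Longrightarrow> pres_eq S R (x @ u @ y) (x @ v @ y)"
| cancel: "s \<in> S \<Longrightarrow> pres_eq S R [(s, b), (s, \<not> b)] []"
| relator: "r \<in> R \<Longrightarrow> pres_eq S R r []"

definition presented_by :: "('a, 'b) monoid_scheme \<Rightarrow> 'a set \<Rightarrow> 'a gword set \<Rightarrow> bool" where
  "presented_by G S R \<longleftrightarrow>
     group G \<and> S \<subseteq> carrier G \<and> generate G S = carrier G \<and>
     (\<forall>u\<in>lists (S \<times> UNIV). \<forall>v\<in>lists (S \<times> UNIV).
        word_eval G u = word_eval G v \<longleftrightarrow> pres_eq S R u v)"

text \<open>The entry \<open>0\<close> of a Coxeter matrix encodes \<open>\<infinity>\<close>; the corresponding relator
  \<open>(s t)\<^sup>0\<close> is the empty word, so it imposes no relation.\<close>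

definition coxeter_matrix :: "'a set \<Rightarrow> ('a \<Rightarrow> 'a \<Rightarrow> nat) \<Rightarrow> bool" where
  "coxeter_matrix S m \<longleftrightarrow>
     (\<forall>s\<in>S. \<forall>t\<in>S. m s t = m t s \<and> (m s t = 1 \<longleftrightarrow> s = t))"

definition coxeter_relators :: "'a set \<Rightarrow> ('a \<Rightarrow> 'a \<Rightarrow> nat) \<Rightarrow> 'a gword set" where
  "coxeter_relators S m =
     {concat (replicate (m s t) [(s, True), (t, True)]) | s t. s \<in> S \<and> t \<in> S}"

definition coxeter_system :: "('a, 'b) monoid_scheme \<Rightarrow> 'a set \<Rightarrow> bool" where
  "coxeter_system W S \<longleftrightarrow>
     (\<exists>m. coxeter_matrix S m \<and> presented_by W S (coxeter_relators S m))"


section \<open>Twisted involutions and their weak order\<close>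

definition twisted_involutions :: "('a, 'b) monoid_scheme \<Rightarrow> ('a \<Rightarrow> 'a) \<Rightarrow> 'a set" where
  "twisted_involutions W \<theta> = {w \<in> carrier W. \<theta> w = inv\<^bsub>W\<^esub> w}"

definition tw_act :: "('a, 'b) monoid_scheme \<Rightarrow> ('a \<Rightarrow> 'a) \<Rightarrow> 'a \<Rightarrow> 'a \<Rightarrow> 'a" where
  "tw_act W \<theta> w s =
     (if \<theta> s \<otimes>\<^bsub>W\<^esub> w \<otimes>\<^bsub>W\<^esub> s = w then w \<otimes>\<^bsub>W\<^esub> s else \<theta> s \<otimes>\<^bsub>W\<^esub> w \<otimes>\<^bsub>W\<^esub> s)"

definition tw_act_word :: "('a, 'b) monoid_scheme \<Rightarrow> ('a \<Rightarrow> 'a) \<Rightarrow> 'a \<Rightarrow> 'a list \<Rightarrow> 'a" where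
  "tw_act_word W \<theta> w ss = foldl (tw_act W \<theta>) w ss"

definition tw_rank :: "('a, 'b) monoid_scheme \<Rightarrow> 'a set \<Rightarrow> ('a \<Rightarrow> 'a) \<Rightarrow> 'a \<Rightarrow> nat" where
  "tw_rank W S \<theta> w =
     (LEAST k. \<exists>ss\<in>lists S. length ss = k \<and> tw_act_word W \<theta> \<one>\<^bsub>W\<^esub> ss = w)"

definition weak_le :: "('a, 'b) monoid_scheme \<Rightarrow> 'a set \<Rightarrow> ('a \<Rightarrow> 'a) \<Rightarrow> 'a \<Rightarrow> 'a \<Rightarrow> bool" where
  "weak_le W S \<theta> v w \<longleftrightarrow>
     v \<in> twisted_involutions W \<theta> \<and> w \<in> twisted_involutions W \<theta> \<and>
     (\<exists>ss\<in>lists S. tw_act_word W \<theta> v ss = w \<and>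
        int (tw_rank W S \<theta> v) = int (tw_rank W S \<theta> w) - int (length ss))"

definition linear_extension :: "'c set \<Rightarrow> ('c \<Rightarrow> 'c \<Rightarrow> bool) \<Rightarrow> 'c list \<Rightarrow> bool" where
  "linear_extension A leq xs \<longleftrightarrow>
     distinct xs \<and> set xs = A \<and>
     (\<forall>i<length xs. \<forall>j<length xs. leq (xs ! i) (xs ! j) \<longrightarrow> i \<le> j)"


section \<open>Edge-labelled graphs\<close>

text \<open>A graph is a pair of a vertex set and a set of labelled edges \<open>({v, w}, s)\<close>; distinct labels
  give distinct parallel edges.\<close>

type_synonym ('v, 'l) lgraph = "'v set \<times> ('v set \<times> 'l) set"

definition subgraph :: "('v, 'l) lgraph \<Rightarrow> ('v, 'l) lgraph \<Rightarrow> bool" where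
  "subgraph g h \<longleftrightarrow> fst g \<subseteq> fst h \<and> snd g \<subseteq> snd h"

definition keep_labels :: "('v, 'l) lgraph \<Rightarrow> 'l set \<Rightarrow> ('v, 'l) lgraph" where
  "keep_labels g J = (fst g, {(e, s) \<in> snd g. s \<in> J})"

definition component :: "('v, 'l) lgraph \<Rightarrow> 'v \<Rightarrow> ('v, 'l) lgraph" where
  "component g w =
     (let V = {v. (w, v) \<in> {(x, y). \<exists>s. ({x, y}, s) \<in> snd g}\<^sup>*}
      in (V, {(e, s) \<in> snd g. e \<subseteq> V}))"

definition tw_graph :: "('a, 'b) monoid_scheme \<Rightarrow> 'a set \<Rightarrow> ('a \<Rightarrow> 'a) \<Rightarrow> ('a, 'a) lgraph" where
  "tw_graph W S \<theta> =
     (twisted_involutions W \<theta>,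
      {({v, w}, s) | v w s. v \<in> twisted_involutions W \<theta> \<and> w \<in> twisted_involutions W \<theta> \<and>
         s \<in> S \<and> tw_act W \<theta> v s = w})"

definition coset_cell ::
  "('a, 'b) monoid_scheme \<Rightarrow> 'a set \<Rightarrow> ('a \<Rightarrow> 'a) \<Rightarrow> 'a set \<Rightarrow> 'a \<Rightarrow> ('a, 'a) lgraph" where
  "coset_cell W S \<theta> J w = component (keep_labels (tw_graph W S \<theta>) J) w"


section \<open>Boolean cell complexes\<close>

text \<open>A finite Boolean cell complex is given by its face poset: a finite poset \<open>P\<close> with order \<open>leq\<close>
  (containment of cells), including the empty cell as least element, in which every lower interval
  is a Boolean lattice. Such a poset determines a regular cell complex in which each closed cell is
  the union of the open cells below it. Hence subcomplexes are down-sets, and unions and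
  intersections of closed cells are computed on the down-sets.\<close>

definition closed_cell :: "'c set \<Rightarrow> ('c \<Rightarrow> 'c \<Rightarrow> bool) \<Rightarrow> 'c \<Rightarrow> 'c set" where
  "closed_cell P leq c = {x \<in> P. leq x c}"

definition boolean_cell_complex :: "'c set \<Rightarrow> ('c \<Rightarrow> 'c \<Rightarrow> bool) \<Rightarrow> bool" where
  "boolean_cell_complex P leq \<longleftrightarrow>
     finite P \<and> reflp_on P leq \<and> antisymp_on P leq \<and> transp_on P leq \<and>
     (\<exists>b\<in>P. \<forall>c\<in>P. leq b c) \<and>
     (\<forall>c\<in>P. \<exists>(n::nat) f. bij_betw f (closed_cell P leq c) (Pow {..<n}) \<and>
        (\<forall>x\<in>closed_cell P leq c. \<forall>y\<in>closed_cell P leq c. leq x y \<longleftrightarrow> f x \<subseteq> f y))"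

text \<open>A 0-cell is a cell with exactly two cells below it: itself and the empty cell. A cell whose
  lower interval is Boolean is a simplex, so its dimension is its number of 0-cells minus one; the
  empty cell has dimension \<open>-1\<close>.\<close>

definition vertices :: "'c set \<Rightarrow> ('c \<Rightarrow> 'c \<Rightarrow> bool) \<Rightarrow> 'c set" where
  "vertices P leq = {x \<in> P. card (closed_cell P leq x) = 2}"

definition cell_dim :: "'c set \<Rightarrow> ('c \<Rightarrow> 'c \<Rightarrow> bool) \<Rightarrow> 'c \<Rightarrow> int" where
  "cell_dim P leq c = int (card (closed_cell P leq c \<inter> vertices P leq)) - 1"

definition facets :: "'c set \<Rightarrow> ('c \<Rightarrow> 'c \<Rightarrow> bool) \<Rightarrow> 'c set" where
  "facets P leq = {F \<in> P. \<forall>c\<in>P. leq F c \<longrightarrow> c = F}"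

definition pure_of_dim :: "'c set \<Rightarrow> ('c \<Rightarrow> 'c \<Rightarrow> bool) \<Rightarrow> int \<Rightarrow> bool" where
  "pure_of_dim P leq d \<longleftrightarrow> (\<forall>F\<in>facets P leq. cell_dim P leq F = d)"

definition shelling_order :: "'c set \<Rightarrow> ('c \<Rightarrow> 'c \<Rightarrow> bool) \<Rightarrow> 'c list \<Rightarrow> bool" where
  "shelling_order P leq Fs \<longleftrightarrow>
     boolean_cell_complex P leq \<and> (\<exists>d. pure_of_dim P leq d) \<and>
     distinct Fs \<and> set Fs = facets P leq \<and>
     (\<forall>i\<in>{1..<length Fs}.
        pure_of_dim (closed_cell P leq (Fs ! i) \<inter> (\<Union>\<alpha><i. closed_cell P leq (Fs ! \<alpha>))) leq
          (cell_dim P leq (Fs ! i) - 1))"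

definition shellable :: "'c set \<Rightarrow> ('c \<Rightarrow> 'c \<Rightarrow> bool) \<Rightarrow> bool" where
  "shellable P leq \<longleftrightarrow> (\<exists>Fs. shelling_order P leq Fs)"


section \<open>The complex of a twisted Coxeter system\<close>

definition Delta_cells ::
  "('a, 'b) monoid_scheme \<Rightarrow> 'a set \<Rightarrow> ('a \<Rightarrow> 'a) \<Rightarrow> ('a, 'a) lgraph set" where
  "Delta_cells W S \<theta> =
     {coset_cell W S \<theta> J w | J w. J \<subseteq> S \<and> w \<in> twisted_involutions W \<theta>}"

definition Delta_le :: "('a, 'a) lgraph \<Rightarrow> ('a, 'a) lgraph \<Rightarrow> bool" where
  "Delta_le g h \<longleftrightarrow> subgraph h g"

end

theory Submission
  imports Defs "HOL-Library.Sublist"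
begin

text \<open>Call \<open>s\<close> a descent of \<open>w\<close> if \<open>len (w \<otimes> s) < len w\<close>. Acting by \<open>s\<close> lowers the length of a
  twisted involution exactly when \<open>s\<close> is a descent. By minimality in double cosets every
  \<open>J\<close>-component has exactly one vertex without descents in \<open>J\<close>. For \<open>J\<close> with two elements both
  descending paths of a component have the same number of steps, so by confluence the rank drops
  by one along every descent, and the vertex without descents in \<open>J\<close> is the weak order minimum of
  its \<open>J\<close>-component. Hence, if the cell \<open>wC\<^sub>J\<close> lies in a facet listed before \<open>w\<close>, then \<open>w\<close> has a
  descent \<open>s \<in> J\<close>, and \<open>wC\<^sub>J\<close> lies in the codimension one cell \<open>wC\<^bsub>{s}\<^esub>\<close>, which is shared with
  the earlier facet of \<open>act w s\<close>.\<close>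

section \<open>Coxeter groups\<close>

locale coxeter_group = group G for G (structure) +
  fixes S :: "'a set"
  assumes coxeter: "coxeter_system G S"
begin

declare in_lists_conv_set [simp] ball_Un [simp]

section \<open>Words in the generators\<close>

definition ev :: "'a list \<Rightarrow> 'a" where
  "ev p = foldr (\<otimes>) p \<one>"

lemma ev_simps [simp]: "ev [] = \<one>" "ev (s # p) = s \<otimes> ev p"
  by (simp_all add: ev_def)

lemma gens_closed [simp]: "s \<in> S \<Longrightarrow> s \<in> carrier G"
  using coxeter unfolding coxeter_system_def presented_by_def by blast

lemma ev_closed [simp]: "p \<in> lists S \<Longrightarrow> ev p \<in> carrier G"
  by (induction p) auto

lemma ev_append: "p \<in> lists S \<Longrightarrow> q \<in> lists S \<Longrightarrow> ev (p @ q) = ev p \<otimes> ev q"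
  by (induction p) (auto simp: m_assoc)

lemma coxeter_presentation:
  obtains m where "coxeter_matrix S m"
    "\<And>u v. u \<in> lists (S \<times> UNIV) \<Longrightarrow> v \<in> lists (S \<times> UNIV) \<Longrightarrow>
       word_eval G u = word_eval G v \<longleftrightarrow> pres_eq S (coxeter_relators S m) u v"
  using coxeter unfolding coxeter_system_def presented_by_def by blast

text \<open>The diagonal entry of a Coxeter matrix is 1, so the word \<open>s s\<close> is itself a
  relator.\<close>

lemma gen_sq [simp]:
  assumes "s \<in> S" shows "s \<otimes> s = \<one>"
proof -
  obtain m where m: "coxeter_matrix S m"
    and eq: "\<And>u v. u \<in> lists (S \<times> UNIV) \<Longrightarrow> v \<in> lists (S \<times> UNIV) \<Longrightarrow>
       word_eval G u = word_eval G v \<longleftrightarrow> pres_eq S (coxeter_relators S m) u v"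
    by (rule coxeter_presentation) blast
  have "m s s = 1"
    using m assms by (auto simp: coxeter_matrix_def)
  then have "concat (replicate 1 [(s, True), (s, True)]) \<in> coxeter_relators S m"
    using assms unfolding coxeter_relators_def by force
  then have "pres_eq S (coxeter_relators S m) [(s, True), (s, True)] []"
    by (auto intro: pres_eq.relator)
  then have "word_eval G [(s, True), (s, True)] = word_eval G []"
    using eq[of "[(s, True), (s, True)]" "[]"] assms by auto
  then show ?thesis
    using assms by simp
qed

lemma gen_inv [simp]: "s \<in> S \<Longrightarrow> inv s = s"
  by (simp add: inv_equality)

lemma gen_cancel [simp]:
  assumes "s \<in> S" "x \<in> carrier G"
  shows "s \<otimes> (s \<otimes> x) = x" "x \<otimes> s \<otimes> s = x"
  using assms by (simp_all add: m_assoc [symmetric]) (simp add: m_assoc)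

lemma inv_cancel [simp]:
  assumes "x \<in> carrier G" "y \<in> carrier G"
  shows "inv x \<otimes> (x \<otimes> y) = y" "x \<otimes> (inv x \<otimes> y) = y"
  using assms by (simp_all add: m_assoc [symmetric])

lemma ev_rev: "p \<in> lists S \<Longrightarrow> ev (rev p) = inv (ev p)"
  by (induction p) (auto simp: ev_append inv_mult_group)

text \<open>Signs can be forgotten because each generator is its own inverse.\<close>

lemma word_eval_ev: "u \<in> lists (S \<times> UNIV) \<Longrightarrow> word_eval G u = ev (map fst u)"
  by (induction u) auto

lemma ev_surj:
  assumes "w \<in> carrier G" obtains p where "p \<in> lists S" "ev p = w"
proof -
  have "w \<in> generate G S"
    using assms coxeter unfolding coxeter_system_def presented_by_def by blast
  then have "\<exists>p\<in>lists S. ev p = w"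
  proof induction
    case one
    show ?case by (rule bexI[of _ "[]"]) simp_all
  next
    case (incl s)
    then show ?case by (intro bexI[of _ "[s]"]) simp_all
  next
    case (inv s)
    then show ?case by (intro bexI[of _ "[s]"]) simp_all
  next
    case (eng x y)
    then obtain p q where "p \<in> lists S" "ev p = x" "q \<in> lists S" "ev q = y"
      by blast
    then show ?case
      using ev_append[of p q] by (intro bexI[of _ "p @ q"]) simp_all
  qed
  then show ?thesis using that by blast
qed

subsection \<open>The parity cocycle and the exchange property\<close>

text \<open>The number of prefixes \<open>q @ [s]\<close> of the word whose reflection \<open>q s q\<^sup>-\<^sup>1\<close> is \<open>x\<close>;
  its parity depends only on the group element.\<close>

fun refl_count :: "'a list \<Rightarrow> 'a \<Rightarrow> nat" where
  "refl_count [] x = 0"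
| "refl_count (s # p) x = of_bool (x = s) + refl_count p (s \<otimes> x \<otimes> s)"

text \<open>A prefix of \<open>p @ q\<close> ending inside \<open>q\<close> gives the corresponding
  reflection of \<open>q\<close> conjugated by \<open>ev p\<close>; hence \<open>x\<close> is pulled
  back along \<open>ev p\<close> in the second summand.\<close>

lemma refl_count_append:
  "p \<in> lists S \<Longrightarrow> q \<in> lists S \<Longrightarrow> x \<in> carrier G \<Longrightarrow>
   refl_count (p @ q) x = refl_count p x + refl_count q (inv (ev p) \<otimes> x \<otimes> ev p)"
  by (induction p arbitrary: x) (auto simp: inv_mult_group m_assoc)

lemma conj_eq_iff:
  assumes "g \<in> carrier G" "x \<in> carrier G" "y \<in> carrier G"
  shows "inv g \<otimes> x \<otimes> g = y \<longleftrightarrow> x = g \<otimes> y \<otimes> inv g"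
proof -
  have "inv g \<otimes> x \<otimes> g = y \<longleftrightarrow> x \<otimes> g = g \<otimes> y"
    using inv_solve_left'[of y g "x \<otimes> g"] assms by (simp only: m_assoc inv_closed m_closed)
  also have "\<dots> \<longleftrightarrow> x = g \<otimes> y \<otimes> inv g"
    using inv_solve_right[of x "g \<otimes> y" g] assms by (metis m_closed)
  finally show ?thesis .
qed

text \<open>The reflection belonging to the prefix of length \<open>j + 1\<close> of the alternating
  word is \<open>(s \<otimes> t) [^] j \<otimes> s\<close>.\<close>

lemma refl_count_dihedral:
  assumes "s \<in> S" "t \<in> S" "x \<in> carrier G"
  shows "refl_count (concat (replicate n [s, t])) x =
    (\<Sum>j<2 * n. of_bool (x = (s \<otimes> t) [^] j \<otimes> s))"
  using assms(3)
proof (induction n arbitrary: x)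
  case 0
  then show ?case by simp
next
  case (Suc n)
  let ?g = "s \<otimes> t"
  have [simp]: "?g \<in> carrier G" "s \<in> carrier G" "t \<in> carrier G"
    using assms by auto
  have inv_g: "inv ?g = t \<otimes> s"
    using assms by (simp add: inv_mult_group)
  \<comment> \<open>Removing the block \<open>s t\<close> conjugates \<open>x\<close> by
    \<open>?g\<close>; since conjugation by \<open>s\<close> inverts \<open>?g\<close>, the exponent
    rises by two.\<close>
  have shift: "t \<otimes> (s \<otimes> x \<otimes> s) \<otimes> t = ?g [^] j \<otimes> s \<longleftrightarrow> x = ?g [^] Suc (Suc j) \<otimes> s" for j
  proof -
    have "t \<otimes> (s \<otimes> x \<otimes> s) \<otimes> t = inv ?g \<otimes> x \<otimes> ?g"
      using Suc.prems assms by (simp add: inv_g m_assoc)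
    moreover have "?g \<otimes> (?g [^] j \<otimes> s) \<otimes> inv ?g = ?g [^] Suc (Suc j) \<otimes> s"
    proof -
      have comm: "?g \<otimes> ?g [^] j = ?g [^] j \<otimes> ?g"
        by (metis \<open>?g \<in> carrier G\<close> nat_pow_Suc nat_pow_Suc2)
      have "?g \<otimes> (?g [^] j \<otimes> s) \<otimes> inv ?g = ?g \<otimes> ?g [^] j \<otimes> (s \<otimes> inv ?g)"
        by (simp add: m_assoc)
      also have "\<dots> = ?g [^] j \<otimes> ?g \<otimes> (?g \<otimes> s)"
        unfolding comm inv_g by (simp add: m_assoc)
      finally show ?thesis
        by (simp add: m_assoc)
    qed
    ultimately show ?thesis
      using conj_eq_iff[of ?g x "?g [^] j \<otimes> s"] Suc.prems by simp
  qed
  have first: "s \<otimes> x \<otimes> s = t \<longleftrightarrow> x = ?g [^] Suc 0 \<otimes> s"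
    using conj_eq_iff[of s x t] Suc.prems assms by simp
  have "refl_count (concat (replicate (Suc n) [s, t])) x =
      of_bool (x = s) + (of_bool (s \<otimes> x \<otimes> s = t) +
      (\<Sum>j<2 * n. of_bool (t \<otimes> (s \<otimes> x \<otimes> s) \<otimes> t = ?g [^] j \<otimes> s)))"
    using Suc.IH[of "t \<otimes> (s \<otimes> x \<otimes> s) \<otimes> t"] Suc.prems assms by simp
  also have "\<dots> = (\<Sum>j<Suc (Suc (2 * n)). of_bool (x = ?g [^] j \<otimes> s))"
    unfolding sum.lessThan_Suc_shift shift first using Suc.prems assms by simp
  finally show ?case by simp
qed

text \<open>As the \<open>n\<close>-th power of \<open>s \<otimes> t\<close> is trivial, the
  summands \<open>j\<close> and \<open>n + j\<close> of the dihedral count agree, so every hit is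
  counted twice.\<close>

lemma refl_count_relator:
  assumes "s \<in> S" "t \<in> S" "x \<in> carrier G" and one: "(s \<otimes> t) [^] (n::nat) = \<one>"
  shows "even (refl_count (concat (replicate n [s, t])) x)"
proof -
  let ?f = "\<lambda>j::nat. of_bool (x = (s \<otimes> t) [^] j \<otimes> s) :: nat"
  have "(\<Sum>j<n + k. ?f j) = (\<Sum>j<n. ?f j) + (\<Sum>j<k. ?f (n + j))" for k
    by (induction k) simp_all
  from this[of n] have "(\<Sum>j<2 * n. ?f j) = (\<Sum>j<n. ?f j) + (\<Sum>j<n. ?f (n + j))"
    by (simp only: mult_2)
  also have "(\<Sum>j<n. ?f (n + j)) = (\<Sum>j<n. ?f j)"
    using assms(1,2) by (simp add: nat_pow_mult[symmetric] one)
  finally show ?thesis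
    using refl_count_dihedral assms by simp
qed

definition gword_letters :: "'a gword \<Rightarrow> 'a list" where
  "gword_letters u = filter (\<lambda>s. s \<in> S) (map fst u)"

lemma gword_letters_append [simp]:
  "gword_letters (u @ v) = gword_letters u @ gword_letters v"
  by (simp add: gword_letters_def)

lemma ev_dihedral:
  "s \<in> S \<Longrightarrow> t \<in> S \<Longrightarrow> ev (concat (replicate n [s, t])) = (s \<otimes> t) [^] n"
proof (induction n)
  case (Suc n)
  then have "ev (concat (replicate (Suc n) [s, t])) = (s \<otimes> t) \<otimes> (s \<otimes> t) [^] n"
    by (simp add: m_assoc)
  also have "\<dots> = (s \<otimes> t) [^] Suc n"
    using Suc.prems by (simp only: nat_pow_Suc2 m_closed gens_closed)
  finally show ?case .
qed simp

text \<open>Letters outside \<open>S\<close> can occur in \<open>pres_eq\<close> through its congruence rule; they are dropped.\<close>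

lemma pres_eq_invariant:
  assumes R: "\<And>s t. s \<in> S \<Longrightarrow> t \<in> S \<Longrightarrow> (s \<otimes> t) [^] m s t = \<one>"
    and "pres_eq S (coxeter_relators S m) u v"
  shows "ev (gword_letters u) = ev (gword_letters v) \<and>
    (\<forall>x\<in>carrier G. even (refl_count (gword_letters u) x) = even (refl_count (gword_letters v) x))"
  using assms(2)
proof induction
  case (cong u v x y)
  let ?l = gword_letters
  have S: "?l w \<in> lists S" for w
    by (auto simp: gword_letters_def)
  have "even (refl_count (?l (x @ u @ y)) z) = even (refl_count (?l (x @ v @ y)) z)"
    if z: "z \<in> carrier G" for z
  proof -
    \<comment> \<open>The common prefix \<open>x\<close> moves \<open>z\<close> to
      \<open>?z\<close>; the common tail \<open>y\<close> is then read at the same point for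
      \<open>u\<close> and \<open>v\<close> because their values agree. This is why the invariant
      carries values and parities together.\<close>
    let ?z = "inv (ev (?l x)) \<otimes> z \<otimes> ev (?l x)"
    have z': "?z \<in> carrier G"
      using z S by (intro m_closed inv_closed ev_closed)
    have "refl_count (?l (x @ w @ y)) z = refl_count (?l x) z +
        (refl_count (?l w) ?z + refl_count (?l y) (inv (ev (?l w)) \<otimes> ?z \<otimes> ev (?l w)))" for w
      using refl_count_append[OF S[of x] S[of "w @ y"] z] refl_count_append[OF S[of w] S[of y] z']
      by simp
    moreover have "ev (?l u) = ev (?l v)" "even (refl_count (?l u) ?z) = even (refl_count (?l v) ?z)"
      using cong.IH z' by blast+
    ultimately show ?thesis
      by (simp only: even_add)
  qed
  then show ?case
    using cong.IH S ev_append append_in_lists_conv gword_letters_append by metis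
next
  case (cancel s b)
  then have "gword_letters [(s, b), (s, \<not> b)] = [s, s]" "gword_letters [] = []"
    by (simp_all add: gword_letters_def)
  \<comment> \<open>Conjugation by \<open>s\<close> maps only \<open>s\<close> itself to
    \<open>s\<close>, so both letters of \<open>s s\<close> are hits or neither is.\<close>
  moreover have "s \<otimes> x \<otimes> s = s \<longleftrightarrow> x = s" if "x \<in> carrier G" for x
    using conj_eq_iff[of s x s] that cancel by (simp add: m_assoc)
  ultimately show ?case
    using cancel by simp
next
  case (relator r)
  then obtain s t where st: "s \<in> S" "t \<in> S" "r = concat (replicate (m s t) [(s, True), (t, True)])"
    by (auto simp: coxeter_relators_def)
  have "gword_letters (concat (replicate n [(s, True), (t, True)])) = concat (replicate n [s, t])" for n
    using st(1,2) by (induction n) (auto simp: gword_letters_def)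
  then have r: "gword_letters r = concat (replicate (m s t) [s, t])"
    by (simp only: st(3))
  have nil: "gword_letters [] = []"
    by (simp add: gword_letters_def)
  have "even (refl_count (gword_letters r) x)" if "x \<in> carrier G" for x
    unfolding r by (rule refl_count_relator[OF st(1,2) that R[OF st(1,2)]])
  then show ?case
    by (simp add: nil) (simp add: r ev_dihedral[OF st(1,2)] R[OF st(1,2)])
next
  case (trans u v w)
  then show ?case by metis
qed simp_all

text \<open>Completeness of the Coxeter relations enters here: words with equal values are linked by
  \<open>pres_eq\<close>, which preserves the parity. Soundness of the relators supplies the
  condition on \<open>m\<close>.\<close>

lemma refl_count_parity:
  assumes "p \<in> lists S" "q \<in> lists S" "ev p = ev q" "x \<in> carrier G"
  shows "even (refl_count p x) = even (refl_count q x)"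
proof -
  obtain m where
    eq: "\<And>u v. u \<in> lists (S \<times> UNIV) \<Longrightarrow> v \<in> lists (S \<times> UNIV) \<Longrightarrow>
       word_eval G u = word_eval G v \<longleftrightarrow> pres_eq S (coxeter_relators S m) u v"
    by (rule coxeter_presentation) blast
  have R: "(s \<otimes> t) [^] m s t = \<one>" if st: "s \<in> S" "t \<in> S" for s t
  proof -
    let ?r = "concat (replicate (m s t) [(s, True), (t, True)])"
    have "pres_eq S (coxeter_relators S m) ?r []"
      using st by (intro pres_eq.relator) (auto simp: coxeter_relators_def)
    moreover have "?r \<in> lists (S \<times> UNIV)"
      using st by (auto simp: set_replicate_conv_if split: if_splits)
    ultimately have "word_eval G ?r = word_eval G []"
      using eq[of ?r "[]"] by auto
    moreover have "map fst ?r = concat (replicate (m s t) [s, t])"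
      by (simp add: map_concat)
    ultimately show ?thesis
      using st \<open>?r \<in> lists (S \<times> UNIV)\<close> by (simp add: word_eval_ev ev_dihedral)
  qed
  let ?e = "map (\<lambda>s. (s, True))"
  have fst_e: "map fst (?e p) = p" "map fst (?e q) = q"
    by (simp_all add: o_def)
  have mem: "?e p \<in> lists (S \<times> UNIV)" "?e q \<in> lists (S \<times> UNIV)"
    using assms by auto
  have "pres_eq S (coxeter_relators S m) (?e p) (?e q)"
    using eq[OF mem] word_eval_ev[OF mem(1)] word_eval_ev[OF mem(2)] assms fst_e by simp
  moreover have "gword_letters (?e p) = p" "gword_letters (?e q) = q"
    using assms unfolding gword_letters_def fst_e by (auto simp: filter_id_conv)
  ultimately show ?thesis
    using pres_eq_invariant[OF R] assms(4) by metis
qed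

text \<open>A positive count exhibits \<open>x\<close> as the reflection \<open>q s q^-1\<close> of
  some prefix, and multiplying by it from the left deletes that letter \<open>s\<close>.\<close>

lemma refl_count_delete:
  assumes "p \<in> lists S" "x \<in> carrier G" "refl_count p x \<noteq> 0"
  shows "\<exists>q s r. p = q @ s # r \<and> x \<otimes> ev p = ev (q @ r)"
  using assms
proof (induction p arbitrary: x)
  case (Cons s p)
  have sp: "s \<in> S" "ev p \<in> carrier G"
    using Cons.hyps by simp_all
  show ?case
  proof (cases "x = s")
    case True
    show ?thesis
    proof (intro exI)
      show "s # p = [] @ s # p \<and> x \<otimes> ev (s # p) = ev ([] @ p)"
        using True sp by simp
    qed
  next
    case False
    then obtain q t r where *: "p = q @ t # r" "(s \<otimes> x \<otimes> s) \<otimes> ev p = ev (q @ r)"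
      using Cons.IH[of "s \<otimes> x \<otimes> s"] Cons.prems sp by auto
    have "x \<otimes> ev (s # p) = s \<otimes> ((s \<otimes> x \<otimes> s) \<otimes> ev p)"
      using Cons.prems sp by (simp add: m_assoc)
    moreover have "s # p = (s # q) @ t # r"
      using *(1) by simp
    ultimately show ?thesis
      using *(2) by (metis append_Cons ev_simps(2))
  qed
qed simp

section \<open>Length, exchange and deletion\<close>

definition len :: "'a \<Rightarrow> nat" where
  "len w = (LEAST k. \<exists>p\<in>lists S. length p = k \<and> ev p = w)"

lemma len_le: "p \<in> lists S \<Longrightarrow> len (ev p) \<le> length p"
  unfolding len_def by (rule Least_le) blast

lemma reduced_word:
  assumes "w \<in> carrier G"
  obtains p where "p \<in> lists S" "ev p = w" "length p = len w"
proof -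
  have "\<exists>k. \<exists>p\<in>lists S. length p = k \<and> ev p = w"
    using ev_surj[OF assms] by blast
  then have "\<exists>p\<in>lists S. length p = len w \<and> ev p = w"
    unfolding len_def by (rule LeastI_ex)
  then show ?thesis using that by blast
qed

lemma len_one [simp]: "len \<one> = 0"
  using len_le[of "[]"] by simp

lemma len_inv:
  assumes "w \<in> carrier G" shows "len (inv w) = len w"
proof -
  have "len (inv x) \<le> len x" if "x \<in> carrier G" for x
    using that reduced_word[OF that] len_le ev_rev
    by (metis in_lists_conv_set length_rev set_rev)
  from this[of w] this[of "inv w"] show ?thesis
    using assms by simp
qed

lemma exchange:
  assumes "s \<in> S" "p \<in> lists S" "len (s \<otimes> ev p) \<le> len (ev p)"
  shows "\<exists>q t r. p = q @ t # r \<and> s \<otimes> ev p = ev (q @ r)"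
proof -
  have "odd (refl_count p s)"
  \<comment> \<open>If the count were even, \<open>s # p\<close> would have an odd count, and so
    would a reduced word \<open>q\<close> of \<open>s \<otimes> ev p\<close>. Deleting a letter of
    \<open>q\<close> then yields a word for \<open>ev p\<close> shorter than \<open>q\<close>,
    contrary to the hypothesis.\<close>
  proof
    assume ev: "even (refl_count p s)"
    obtain q where q: "q \<in> lists S" "ev q = s \<otimes> ev p" "length q = len (s \<otimes> ev p)"
      using reduced_word[of "s \<otimes> ev p"] assms by auto
    have "odd (refl_count (s # p) s)"
      using ev assms(1) by simp
    then have "odd (refl_count q s)"
      using refl_count_parity[of q "s # p" s] q assms by auto
    then obtain a t b where ab: "q = a @ t # b" "s \<otimes> ev q = ev (a @ b)"
      using refl_count_delete[of q s] q assms(1) by (metis gens_closed even_zero)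
    have "a @ b \<in> lists S"
      using q ab by auto
    then have "len (s \<otimes> ev q) < length q"
      using len_le[of "a @ b"] ab by simp
    then show False
      using q assms by simp
  qed
  then show ?thesis
    using refl_count_delete[of p s] assms by (metis gens_closed even_zero)
qed

lemma len_mult_left:
  assumes "s \<in> S" "w \<in> carrier G"
  shows "len (s \<otimes> w) = len w + 1 \<or> len w = len (s \<otimes> w) + 1"
proof -
  have up: "len (s \<otimes> x) \<le> len x + 1" if "x \<in> carrier G" for x
    using reduced_word[OF that] len_le[of "s # _"] assms(1)
    by (metis Suc_eq_plus1 ev_simps(2) length_Cons lists.Cons)
  obtain p where p: "p \<in> lists S" "ev p = w" "length p = len w"
    using reduced_word assms by blast
  have "len (s \<otimes> w) < len w" if le: "len (s \<otimes> w) \<le> len w"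
  proof -
    obtain q t r where "p = q @ t # r" "s \<otimes> w = ev (q @ r)"
      using exchange[of s p] assms p le by auto
    then show ?thesis
      using len_le[of "q @ r"] p by auto
  qed
  then show ?thesis
    using up[of w] up[of "s \<otimes> w"] assms by fastforce
qed

lemma len_mult_right:
  assumes "s \<in> S" "w \<in> carrier G"
  shows "len (w \<otimes> s) = len w + 1 \<or> len w = len (w \<otimes> s) + 1"
  using len_mult_left[of s "inv w"] len_inv[of "w \<otimes> s"] len_inv[of w] assms
  by (simp add: inv_mult_group)

text \<open>Letters are added from the left: a new letter either lengthens the reduced subword or,
  by exchange, cancels one of its letters.\<close>

lemma reduced_subword:
  "p \<in> lists S \<Longrightarrow> \<exists>q. subseq q p \<and> ev q = ev p \<and> length q = len (ev p)"
proof (induction p)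
  case (Cons s p)
  then obtain q where q: "subseq q p" "ev q = ev p" "length q = len (ev p)"
    by auto
  have qS: "q \<in> lists S"
    using q(1) Cons.prems by (auto elim!: list_emb_set)
  show ?case
  proof (cases "len (s \<otimes> ev p) = len (ev p) + 1")
    case True
    then show ?thesis
      using q by (intro exI[of _ "s # q"]) auto
  next
    case False
    then have down: "len (ev p) = len (s \<otimes> ev p) + 1"
      using len_mult_left[of s "ev p"] Cons.prems by auto
    then obtain a t b where ab: "q = a @ t # b" "s \<otimes> ev q = ev (a @ b)"
      using exchange[of s q] q qS Cons.prems by auto
    have "subseq (a @ b) q"
      unfolding ab by (simp add: list_emb_append_mono subseq_Cons')
    then have "subseq (a @ b) (s # p)"
      using q(1) by (meson subseq_order.order_trans list_emb_Cons)
    then show ?thesis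
      using ab q down by (intro exI[of _ "a @ b"]) auto
  qed
qed auto

section \<open>Multiplication on both sides and minimal double coset representatives\<close>

lemma two_sided_descent:
  assumes "a \<in> S" "s \<in> S" "w \<in> carrier G" "len (a \<otimes> w) < len w" "len (w \<otimes> s) < len w"
  shows "a \<otimes> w \<otimes> s = w \<or> len (a \<otimes> w \<otimes> s) + 2 = len w"
proof -
  obtain p where p: "p \<in> lists S" "ev p = w \<otimes> s" "length p = len (w \<otimes> s)"
    using reduced_word[of "w \<otimes> s"] assms by auto
  have w: "ev (p @ [s]) = w"
    using p assms by (simp add: ev_append m_assoc)
  have lw: "len w = len (w \<otimes> s) + 1"
    using len_mult_right[of s w] assms by auto
  \<comment> \<open>Exchange deletes a letter of a reduced word ending in \<open>s\<close>. Deleting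
    the final \<open>s\<close> gives the commuting case; deleting an earlier letter leaves
    \<open>s\<close> in place, to be removed by the multiplication on the right.\<close>
  obtain q t r where q: "p @ [s] = q @ t # r" "a \<otimes> w = ev (q @ r)"
    using exchange[of a "p @ [s]"] w p assms by auto
  show ?thesis
  proof (cases r rule: rev_cases)
    case Nil
    then have "a \<otimes> w = w \<otimes> s"
      using q p by simp
    then show ?thesis using assms by simp
  next
    case (snoc r' s')
    then have pq: "p = q @ t # r'" "s' = s"
      using q by auto
    then have "q @ r' \<in> lists S"
      using p by auto
    then have "a \<otimes> w \<otimes> s = ev (q @ r')"
      using q snoc pq assms ev_append[of "q @ r'" "[s]"] by auto
    then have "len (a \<otimes> w \<otimes> s) < len (w \<otimes> s)"
      using len_le[OF \<open>q @ r' \<in> lists S\<close>] pq p by simp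
    then show ?thesis
      using len_mult_right[of s "a \<otimes> w"] len_mult_left[of a w] assms lw
        len_mult_left[of a "w \<otimes> s"] by (auto simp: m_assoc)
  qed
qed

text \<open>If \<open>a\<close> shortens \<open>w \<otimes> s\<close>, then
  \<open>two_sided_descent\<close> for \<open>w \<otimes> s\<close> leaves only
  \<open>a \<otimes> w = w \<otimes> s\<close>; otherwise the two multiplications lengthen one after
  the other.\<close>

lemma two_sided_ascent:
  assumes "a \<in> S" "s \<in> S" "w \<in> carrier G" "len w < len (a \<otimes> w)" "len w < len (w \<otimes> s)"
  shows "a \<otimes> w \<otimes> s = w \<or> len (a \<otimes> w \<otimes> s) = len w + 2"
proof (cases "len (a \<otimes> (w \<otimes> s)) < len (w \<otimes> s)")
  case True
  then have "a \<otimes> (w \<otimes> s) \<otimes> s = w \<otimes> s \<or> len (a \<otimes> (w \<otimes> s) \<otimes> s) + 2 = len (w \<otimes> s)"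
    using two_sided_descent[of a s "w \<otimes> s"] assms by auto
  then have "a \<otimes> w = w \<otimes> s \<or> len (a \<otimes> w) + 2 = len (w \<otimes> s)"
    using assms by (simp add: m_assoc)
  then show ?thesis
    using assms len_mult_right[of s w] by auto
next
  case False
  then show ?thesis
    using assms len_mult_right[of s w] len_mult_left[of a "w \<otimes> s"] by (auto simp: m_assoc)
qed

text \<open>A word \<open>a p b\<close> for \<open>u\<close> contains a reduced word
  \<open>a' p' b'\<close> for \<open>u\<close>. Minimality of \<open>d\<close> forces
  \<open>p' = p\<close>, and a letter surviving in \<open>a'\<close> or \<open>b'\<close> would be
  an excluded descent of \<open>u\<close>.\<close>

lemma min_double_coset_rep:
  assumes J: "J \<subseteq> S" and K: "K \<subseteq> S"
    and d: "d \<in> carrier G"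
    and u: "u \<in> carrier G" "\<And>s. s \<in> K \<Longrightarrow> len u < len (s \<otimes> u)" "\<And>s. s \<in> J \<Longrightarrow> len u < len (u \<otimes> s)"
    and ab: "a \<in> lists K" "b \<in> lists J" "u = ev a \<otimes> d \<otimes> ev b"
    and min: "\<And>a b. a \<in> lists K \<Longrightarrow> b \<in> lists J \<Longrightarrow> len d \<le> len (ev a \<otimes> d \<otimes> ev b)"
  shows "u = d"
proof -
  have abS: "a \<in> lists S" "b \<in> lists S"
    using ab J K by auto
  obtain p where p: "p \<in> lists S" "ev p = d" "length p = len d"
    using reduced_word[OF d] by blast
  have S: "a @ p @ b \<in> lists S" and u_ev: "ev (a @ p @ b) = u"
    using ab(3) p abS d by (simp_all add: ev_append m_assoc)
  obtain q where q: "subseq q (a @ p @ b)" "ev q = u" "length q = len u"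
    using reduced_subword[OF S] unfolding u_ev by blast
  obtain a' p' b' where q': "q = a' @ p' @ b'" "subseq a' a" "subseq p' p" "subseq b' b"
    using q(1) unfolding subseq_append_iff by metis
  have mem: "a' \<in> lists K" "p' \<in> lists S" "b' \<in> lists J"
    using q'(2-4) ab(1,2) p(1) by (auto elim!: list_emb_set)
  have memS: "a' \<in> lists S" "b' \<in> lists S"
    using mem J K by auto
  have u': "u = ev a' \<otimes> ev p' \<otimes> ev b'"
    using q(2) q'(1) mem(2) memS by (simp add: ev_append m_assoc)
  \<comment> \<open>Solving for \<open>ev p'\<close> places it in the double coset of
    \<open>d\<close>, so \<open>p'\<close> is no shorter than \<open>p\<close>, of which it is a
    subword.\<close>
  have "ev p' = inv (ev a') \<otimes> u \<otimes> inv (ev b')"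
    unfolding u' using mem(2) memS by (simp add: m_assoc inv_solve_left)
  also have "\<dots> = ev (rev a' @ a) \<otimes> d \<otimes> ev (b @ rev b')"
    unfolding ab(3) using memS abS d by (simp add: ev_append ev_rev m_assoc)
  finally have "len d \<le> length p'"
    using min[of "rev a' @ a" "b @ rev b'"] mem ab(1,2) len_le[of p'] by auto
  then have "p' = p"
    using q'(3) p(3) subseq_same_length list_emb_length by (metis le_antisym)
  have "a' = []"
  proof (cases a')
    case (Cons s a'')
    have S: "a'' @ p' @ b' \<in> lists S" "s \<in> S"
      using mem(2) memS Cons by auto
    have "s \<otimes> u = ev (a'' @ p' @ b')"
      using q(2) q'(1) Cons S by auto
    then have "len (s \<otimes> u) < len u"
      using len_le[OF S(1)] q(3) q'(1) Cons by simp
    then show ?thesis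
      using u(2)[of s] Cons mem by auto
  qed simp
  moreover have "b' = []"
  proof (cases b' rule: rev_cases)
    case (snoc b'' s)
    have S: "a' @ p' @ b'' \<in> lists S" "s \<in> S"
      using mem(2) memS snoc by auto
    have "u = ev ((a' @ p' @ b'') @ [s])"
      using q(2) q'(1) snoc by simp
    then have "u \<otimes> s = ev (a' @ p' @ b'')"
      using ev_append[OF S(1), of "[s]"] S ev_closed[OF S(1)] by (simp del: ev_closed)
    then have "len (u \<otimes> s) < len u"
      using len_le[OF S(1)] q(3) q'(1) snoc by simp
    then show ?thesis
      using u(3)[of s] snoc mem by auto
  qed simp
  ultimately show ?thesis
    using u' \<open>p' = p\<close> p d by simp
qed

text \<open>Both elements are compared with a shortest element \<open>d\<close> of their common
  double coset.\<close>

lemma min_double_coset_unique: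
  assumes J: "J \<subseteq> S" and K: "K \<subseteq> S"
    and u: "u \<in> carrier G" "\<And>s. s \<in> K \<Longrightarrow> len u < len (s \<otimes> u)" "\<And>s. s \<in> J \<Longrightarrow> len u < len (u \<otimes> s)"
    and v: "\<And>s. s \<in> K \<Longrightarrow> len v < len (s \<otimes> v)" "\<And>s. s \<in> J \<Longrightarrow> len v < len (v \<otimes> s)"
    and ab: "a \<in> lists K" "b \<in> lists J" "v = ev a \<otimes> u \<otimes> ev b"
  shows "u = v"
proof -
  have mono: "p \<in> lists S" if "p \<in> lists J \<or> p \<in> lists K" for p
    using that J K by auto
  define D where "D = (\<lambda>(p, q). ev p \<otimes> u \<otimes> ev q) ` (lists K \<times> lists J)"
  have "u \<in> D"
    unfolding D_def using u(1) by (intro image_eqI[of _ _ "([], [])"]) simp_all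
  then obtain d where d: "d \<in> D" "\<And>x. x \<in> D \<Longrightarrow> len d \<le> len x"
    using ex_has_least_nat[of "\<lambda>x. x \<in> D" u len] by blast
  then obtain p q where pq: "p \<in> lists K" "q \<in> lists J" "d = ev p \<otimes> u \<otimes> ev q"
    by (auto simp: D_def)
  have S: "p \<in> lists S" "q \<in> lists S" "a \<in> lists S" "b \<in> lists S"
    using pq ab mono by blast+
  have dG: "d \<in> carrier G"
    using pq(3) S(1,2) u(1) by simp
  have inv: "ev (p' @ rev p) \<otimes> d \<otimes> ev (rev q @ q') = ev p' \<otimes> u \<otimes> ev q'"
    if "p' \<in> lists S" "q' \<in> lists S" for p' q'
    unfolding pq(3) using that S u(1) by (simp add: ev_append ev_rev m_assoc)
  have min: "len d \<le> len (ev x \<otimes> d \<otimes> ev y)" if xy: "x \<in> lists K" "y \<in> lists J" for x y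
  proof (rule d(2))
    have "x \<in> lists S" "y \<in> lists S"
      using xy mono by blast+
    then have "ev x \<otimes> d \<otimes> ev y = ev (x @ p) \<otimes> u \<otimes> ev (q @ y)"
      unfolding pq(3) using S u(1) by (simp add: ev_append m_assoc)
    then show "ev x \<otimes> d \<otimes> ev y \<in> D"
      unfolding D_def using xy pq(1,2) by (intro image_eqI[of _ _ "(x @ p, q @ y)"]) auto
  qed
  \<comment> \<open>The words linking \<open>d\<close> to \<open>u\<close> and \<open>v\<close> come
    from reversing the words \<open>p\<close> and \<open>q\<close> that lead from \<open>u\<close>
    to \<open>d\<close>.\<close>
  have "u = d"
    by (rule min_double_coset_rep[OF J K dG u, of "rev p" "rev q"])
      (use min pq(1,2) inv[of "[]" "[]"] u(1) S in auto)
  moreover have "v = d"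
    by (rule min_double_coset_rep[OF J K dG _ v, of "a @ rev p" "rev q @ b"])
      (use min pq(1,2) inv[OF S(3,4)] u(1) S ab in auto)
  ultimately show ?thesis by simp
qed

end

section \<open>Twisted involutions\<close>

locale twisted_coxeter = coxeter_group +
  fixes \<theta> :: "'a \<Rightarrow> 'a"
  assumes theta_iso: "\<theta> \<in> iso G G"
    and theta_theta [simp]: "x \<in> carrier G \<Longrightarrow> \<theta> (\<theta> x) = x"
    and theta_gens: "\<theta> ` S = S"
begin

abbreviation (input) I where "I \<equiv> twisted_involutions G \<theta>"
abbreviation (input) act where "act \<equiv> tw_act G \<theta>"

lemma theta_mult: "x \<in> carrier G \<Longrightarrow> y \<in> carrier G \<Longrightarrow> \<theta> (x \<otimes> y) = \<theta> x \<otimes> \<theta> y"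
  using theta_iso by (auto simp: iso_def hom_def)

lemma theta_closed [simp]: "x \<in> carrier G \<Longrightarrow> \<theta> x \<in> carrier G"
  using theta_iso by (auto simp: iso_def hom_def)

lemma theta_gen [simp]: "s \<in> S \<Longrightarrow> \<theta> s \<in> S"
  using theta_gens by blast

lemma theta_one: "\<theta> \<one> = \<one>"
  using theta_mult[of \<one> \<one>] by (metis l_cancel_one' one_closed l_one theta_closed)

lemma len_theta:
  assumes "w \<in> carrier G" shows "len (\<theta> w) = len w"
proof -
  have le: "len (\<theta> x) \<le> len x" if x: "x \<in> carrier G" for x
  proof -
    obtain p where p: "p \<in> lists S" "ev p = x" "length p = len x"
      using reduced_word[OF x] by blast
    have "ev (map \<theta> q) = \<theta> (ev q)" if "q \<in> lists S" for q
      using that by (induction q) (auto simp: theta_one theta_mult)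
    from this[OF p(1)] show ?thesis
      using len_le[of "map \<theta> p"] p by auto
  qed
  from le[OF assms] le[of "\<theta> w"] show ?thesis
    using assms by simp
qed

lemma tw_iff: "w \<in> carrier G \<Longrightarrow> w \<in> I \<longleftrightarrow> \<theta> w = inv w"
  by (simp add: twisted_involutions_def)

lemma one_tw [simp]: "\<one> \<in> I"
  by (simp add: tw_iff theta_one)

lemma tw_carrier [simp]: "w \<in> I \<Longrightarrow> w \<in> carrier G"
  unfolding twisted_involutions_def by blast

lemma theta_tw: "w \<in> I \<Longrightarrow> \<theta> w = inv w"
  unfolding twisted_involutions_def by blast

lemma fixed_iff:
  assumes "s \<in> S" "w \<in> carrier G"
  shows "\<theta> s \<otimes> w \<otimes> s = w \<longleftrightarrow> \<theta> s \<otimes> w = w \<otimes> s"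
proof
  assume "\<theta> s \<otimes> w \<otimes> s = w"
  then show "\<theta> s \<otimes> w = w \<otimes> s"
    using gen_cancel(2)[OF assms(1), of "\<theta> s \<otimes> w"] assms by simp
qed (use assms in simp)

lemma act_closed [simp]:
  assumes "w \<in> I" "s \<in> S" shows "act w s \<in> I"
proof -
  have G: "w \<in> carrier G" "s \<in> carrier G" "\<theta> s \<in> carrier G" and inv: "inv (\<theta> s) = \<theta> s"
    using assms by simp_all
  show ?thesis
  proof (cases "\<theta> s \<otimes> w \<otimes> s = w")
    case True
    then have "inv (w \<otimes> s) = inv (\<theta> s \<otimes> w)"
      using fixed_iff assms by simp
    also have "\<dots> = \<theta> (w \<otimes> s)"
      using G assms inv theta_tw by (simp add: theta_mult inv_mult_group)
    finally show ?thesis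
      using True G tw_iff[of "w \<otimes> s"] by (simp add: tw_act_def)
  next
    case False
    moreover have "\<theta> (\<theta> s \<otimes> w \<otimes> s) = inv (\<theta> s \<otimes> w \<otimes> s)"
      using G assms inv theta_tw[OF assms(1)] by (simp add: theta_mult inv_mult_group m_assoc)
    ultimately show ?thesis
      using G tw_iff[of "\<theta> s \<otimes> w \<otimes> s"] by (simp add: tw_act_def)
  qed
qed

text \<open>The two cases of the action do not mix: whether
  \<open>\<theta> s \<otimes> w \<otimes> s\<close> equals \<open>w\<close> is unchanged by acting
  with \<open>s\<close>, so the second application undoes the first.\<close>

lemma act_act [simp]:
  assumes "w \<in> I" "s \<in> S" shows "act (act w s) s = w"
proof (cases "\<theta> s \<otimes> w \<otimes> s = w")
  case True
  then have "\<theta> s \<otimes> (w \<otimes> s) \<otimes> s = w \<otimes> s"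
    using assms by (simp add: m_assoc)
  then show ?thesis
    using True assms by (simp add: tw_act_def)
next
  case False
  moreover have "\<theta> s \<otimes> (\<theta> s \<otimes> w \<otimes> s) \<otimes> s = w"
    using assms by (simp add: m_assoc)
  ultimately show ?thesis
    by (simp add: tw_act_def)
qed

section \<open>Descents of twisted involutions\<close>

definition desc :: "'a \<Rightarrow> 'a \<Rightarrow> bool" where
  "desc s w \<longleftrightarrow> len (w \<otimes> s) < len w"

text \<open>Inversion followed by \<open>\<theta>\<close> carries
  \<open>\<theta> s \<otimes> w\<close> to \<open>w \<otimes> s\<close>, and both maps preserve
  length. Hence right descents determine the left ones.\<close>

lemma len_left_right:
  assumes "w \<in> I" "s \<in> S" shows "len (\<theta> s \<otimes> w) = len (w \<otimes> s)"
proof -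
  have "inv (\<theta> s \<otimes> w) = \<theta> (w \<otimes> s)"
    using assms theta_tw[of w] by (simp add: theta_mult inv_mult_group)
  then show ?thesis
    using len_inv[of "\<theta> s \<otimes> w"] len_theta[of "w \<otimes> s"] assms by simp
qed

text \<open>The drop is 1 in the commuting case, where only \<open>s\<close> on the right is
  multiplied, and 2 otherwise.\<close>

lemma len_act_desc:
  assumes "w \<in> I" "s \<in> S" "desc s w"
  shows "len w = len (act w s) + 1 \<or> len w = len (act w s) + 2"
  using two_sided_descent[of "\<theta> s" s w] len_left_right[of w s] len_mult_right[of s w] assms
  by (auto simp: tw_act_def desc_def)

lemma len_act_not_desc:
  assumes "w \<in> I" "s \<in> S" "\<not> desc s w"
  shows "len (act w s) = len w + 1 \<or> len (act w s) = len w + 2"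
  using two_sided_ascent[of "\<theta> s" s w] len_left_right[of w s] len_mult_right[of s w] assms
  by (auto simp: tw_act_def desc_def)

lemma desc_iff: "w \<in> I \<Longrightarrow> s \<in> S \<Longrightarrow> desc s w \<longleftrightarrow> len (act w s) < len w"
  using len_act_desc[of w s] len_act_not_desc[of w s] by (cases "desc s w") auto

lemma desc_act: "w \<in> I \<Longrightarrow> s \<in> S \<Longrightarrow> desc s (act w s) \<longleftrightarrow> \<not> desc s w"
  using desc_iff[of w s] desc_iff[of "act w s" s] len_act_not_desc[of w s]
  by (cases "desc s w") auto

lemma act_neq: "w \<in> I \<Longrightarrow> s \<in> S \<Longrightarrow> act w s \<noteq> w"
  using desc_act by metis

lemma no_desc_one [simp]: "\<not> desc s \<one>"
  by (simp add: desc_def)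

lemma ex_desc:
  assumes "w \<in> I" "w \<noteq> \<one>" obtains s where "s \<in> S" "desc s w"
proof -
  obtain p where p: "p \<in> lists S" "ev p = w" "length p = len w"
    using reduced_word[of w] assms by auto
  show thesis
  proof (cases p rule: rev_cases)
    case Nil
    then show ?thesis using p assms by simp
  next
    case (snoc q s)
    have S: "q \<in> lists S" "s \<in> S"
      using p snoc by auto
    then have "w \<otimes> s = ev q"
      using p(2) snoc ev_append[OF S(1), of "[s]"] ev_closed[OF S(1)] by (auto simp del: ev_closed)
    then have "desc s w"
      using len_le[OF S(1)] p snoc by (simp add: desc_def)
    then show ?thesis using that S by blast
  qed
qed

text \<open>If \<open>act w s\<close> is \<open>w \<otimes> s = \<theta> s \<otimes> w\<close>, then the left descent \<open>\<theta> t\<close> of \<open>w\<close> survives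
  multiplication by \<open>s\<close> on the right.\<close>

lemma desc_act_fixed:
  assumes "w \<in> I" "s \<in> S" "t \<in> S" "desc t w" "len (act w s) = len w + 1"
  shows "desc t (act w s)"
proof -
  have up: "\<not> desc s w"
    using assms desc_iff by auto
  \<comment> \<open>The increase by 1 rules out the other case of the action, in which the length
    grows by 2.\<close>
  have eq: "act w s = w \<otimes> s"
    using two_sided_ascent[of "\<theta> s" s w] up len_left_right[of w s] len_mult_right[of s w] assms
    by (auto simp: tw_act_def desc_def)
  have "len (\<theta> t \<otimes> (w \<otimes> s)) \<le> len (\<theta> t \<otimes> w) + 1"
    using len_mult_right[of s "\<theta> t \<otimes> w"] assms by (auto simp: m_assoc)
  also have "\<dots> \<le> len w"
    using assms len_left_right[of w t] by (simp add: desc_def)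
  finally have "len (\<theta> t \<otimes> act w s) < len (act w s)"
    using assms eq by simp
  then show ?thesis
    using len_left_right[of "act w s" t] assms by (simp add: desc_def)
qed

section \<open>Components as orbits of the action\<close>

definition steps :: "'a set \<Rightarrow> ('a \<times> 'a) set" where
  "steps J = {(x, act x s) | x s. x \<in> I \<and> s \<in> J}"

lemma stepsI: "x \<in> I \<Longrightarrow> s \<in> J \<Longrightarrow> (x, act x s) \<in> steps J"
  unfolding steps_def by blast

lemma steps_tw:
  assumes "(u, v) \<in> (steps J)\<^sup>*" "u \<in> I" "J \<subseteq> S" shows "v \<in> I"
  using assms by (induction rule: rtrancl_induct) (auto simp: steps_def)

lemma sym_steps:
  assumes "J \<subseteq> S" shows "sym ((steps J)\<^sup>*)"
proof (intro sym_rtrancl symI)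
  fix x y assume "(x, y) \<in> steps J"
  then obtain s where s: "x \<in> I" "s \<in> J" "s \<in> S" "y = act x s"
    using assms by (auto simp: steps_def)
  then have "(act x s, act (act x s) s) \<in> steps J"
    by (intro stepsI) simp_all
  then show "(y, x) \<in> steps J"
    using s by simp
qed

text \<open>Each step multiplies by \<open>s\<close> on the right and possibly by
  \<open>\<theta> s\<close> on the left, which keeps the walk inside one double coset.\<close>

lemma steps_double_coset:
  assumes "(u, v) \<in> (steps J)\<^sup>*" "u \<in> I" "J \<subseteq> S"
  shows "\<exists>a\<in>lists (\<theta> ` J). \<exists>b\<in>lists J. v = ev a \<otimes> u \<otimes> ev b"
  using assms
proof (induction rule: rtrancl_induct)
  case base
  then show ?case by (intro bexI[of _ "[]"]) simp_all
next
  case (step v w)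
  then obtain a b where ab: "a \<in> lists (\<theta> ` J)" "b \<in> lists J" "v = ev a \<otimes> u \<otimes> ev b"
    by blast
  obtain s where s: "s \<in> J" "w = act v s"
    using step by (auto simp: steps_def)
  have "\<theta> ` J \<subseteq> S"
    using step.prems theta_gens by blast
  then have S: "a \<in> lists S" "b \<in> lists S" "s \<in> S"
    using ab s step.prems by auto
  have u: "u \<in> carrier G"
    using step.prems by simp
  have "w = ev a \<otimes> u \<otimes> ev (b @ [s]) \<or> w = ev (\<theta> s # a) \<otimes> u \<otimes> ev (b @ [s])"
    using s(2) S u ab(3) by (auto simp: tw_act_def ev_append m_assoc)
  moreover have "b @ [s] \<in> lists J" "\<theta> s # a \<in> lists (\<theta> ` J)"
    using ab s by auto
  ultimately show ?case
    using ab(1) by blast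
qed

text \<open>By \<open>len_left_right\<close>, having no descents in \<open>J\<close> means
  minimality on both sides, so double coset uniqueness applies with \<open>K\<close> the image of
  \<open>J\<close> under \<open>\<theta>\<close>.\<close>

lemma component_min_unique:
  assumes uv: "(u, v) \<in> (steps J)\<^sup>*" and uI: "u \<in> I" and J: "J \<subseteq> S"
    and "\<And>s. s \<in> J \<Longrightarrow> \<not> desc s u" "\<And>s. s \<in> J \<Longrightarrow> \<not> desc s v"
  shows "u = v"
proof -
  have vI: "v \<in> I"
    using steps_tw[OF uv uI J] .
  obtain a b where ab: "a \<in> lists (\<theta> ` J)" "b \<in> lists J" "v = ev a \<otimes> u \<otimes> ev b"
    using steps_double_coset[OF uv uI J] by blast
  have up: "len x < len (x \<otimes> s) \<and> len x < len (\<theta> s \<otimes> x)" if "x \<in> I" "s \<in> J" "\<not> desc s x" for x s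
    using that J len_mult_right[of s x] len_left_right[of x s] by (auto simp: desc_def)
  show ?thesis
    by (rule min_double_coset_unique[OF J, of "\<theta> ` J" u v a b])
      (use up uI vI assms ab theta_gens in auto)
qed

subsection \<open>The rank function\<close>

definition alt :: "'a \<Rightarrow> 'a \<Rightarrow> nat \<Rightarrow> 'a" where
  "alt s t n = (if even n then s else t)"

text \<open>For a given first letter this alternating walk is the only one in a two-label component
  that never undoes its previous step.\<close>

primrec chain :: "'a \<Rightarrow> 'a \<Rightarrow> 'a \<Rightarrow> nat \<Rightarrow> 'a" where
  "chain w s t 0 = w"
| "chain w s t (Suc n) = act (chain w s t n) (alt s t n)"

lemma alt_gen [simp]: "s \<in> S \<Longrightarrow> t \<in> S \<Longrightarrow> alt s t n \<in> S"
  by (simp add: alt_def)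

lemma chain_tw [simp]: "w \<in> I \<Longrightarrow> s \<in> S \<Longrightarrow> t \<in> S \<Longrightarrow> chain w s t n \<in> I"
  by (induction n) simp_all

lemma chain_steps: "w \<in> I \<Longrightarrow> s \<in> S \<Longrightarrow> t \<in> S \<Longrightarrow> (w, chain w s t n) \<in> (steps {s, t})\<^sup>*"
proof (induction n)
  case (Suc n)
  then have "(chain w s t n, chain w s t (Suc n)) \<in> steps {s, t}"
    using stepsI[of "chain w s t n" "alt s t n"] by (simp add: alt_def)
  with Suc show ?case by (meson rtrancl.rtrancl_into_rtrancl)
qed simp

text \<open>The last letters of the two chains coincide and cancel by \<open>act_act\<close>, down
  to lengths 0 and 1. With \<open>act_neq\<close> this forbids a meeting after \<open>a\<close> and
  \<open>a + 1\<close> steps.\<close>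

lemma chain_shift:
  assumes "w \<in> I" "s \<in> S" "t \<in> S"
  shows "chain w s t a = chain w t s (Suc a) \<Longrightarrow> act w t = w"
proof (induction a)
  case 0
  then show ?case by (simp add: alt_def)
next
  case (Suc a)
  have alt: "alt t s (Suc a) = alt s t a"
    by (simp add: alt_def)
  have "act (chain w s t (Suc a)) (alt s t a) = act (chain w t s (Suc (Suc a))) (alt t s (Suc a))"
    using Suc.prems alt by simp
  then have "chain w s t a = chain w t s (Suc a)"
    using assms by (simp del: chain.simps(2) add: chain.simps(2)[of w s t a] chain.simps(2)[of w t s "Suc a"])
  then show ?case
    by (rule Suc.IH)
qed

text \<open>A step changing the length by \<open>1\<close> can only be the first or the last one of a chain descending
  to its bottom, by \<open>desc_act_fixed\<close>. So the length drop determines the number of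
  steps up to \<open>1\<close>.\<close>

lemma chain_bottom:
  assumes w: "w \<in> I" "s \<in> S" "t \<in> S" "desc s w" "desc t w"
  obtains a where "a > 0" "\<And>i. i < a \<Longrightarrow> desc (alt s t i) (chain w s t i)"
    "\<not> desc s (chain w s t a)" "\<not> desc t (chain w s t a)"
    "len w \<le> len (chain w s t a) + 2 * a" "len (chain w s t a) + 2 * a \<le> len w + 2"
proof -
  let ?A = "chain w s t"
  define a where "a = (LEAST i. \<not> desc (alt s t i) (?A i))"
  have "\<exists>i. \<not> desc (alt s t i) (?A i)"
  proof (rule ccontr)
    assume "\<nexists>i. \<not> desc (alt s t i) (?A i)"
    then have step: "len (?A (Suc i)) < len (?A i)" for i
      using desc_iff[of "?A i" "alt s t i"] w by simp
    have "len (?A i) + i \<le> len w" for i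
    proof (induction i)
      case (Suc i)
      then show ?case using step[of i] by linarith
    qed simp
    from this[of "Suc (len w)"] show False by simp
  qed
  then have bot: "\<not> desc (alt s t a) (?A a)"
    unfolding a_def by (rule LeastI_ex)
  have down: "desc (alt s t i) (?A i)" if "i < a" for i
    using not_less_Least[of i "\<lambda>i. \<not> desc (alt s t i) (?A i)"] that by (auto simp: a_def)
  have "a > 0"
    using bot w by (cases a) (auto simp: alt_def)
  then obtain b where b: "a = Suc b"
    by (cases a) auto
  \<comment> \<open>This is the letter used last, and acting with a descent turns it into an
    ascent.\<close>
  have "\<not> desc (alt s t b) (?A a)"
    using desc_act[of "?A b" "alt s t b"] down[of b] w b by simp
  then have min: "\<not> desc s (?A a)" "\<not> desc t (?A a)"
    using bot b by (auto simp: alt_def split: if_splits)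
  have drop: "len (?A i) = len (?A (Suc i)) + 1 \<or> len (?A i) = len (?A (Suc i)) + 2" if "i < a" for i
    using len_act_desc[of "?A i" "alt s t i"] down[OF that] w by simp
  have drop2: "len (?A i) = len (?A (Suc i)) + 2" if i: "0 < i" "Suc i < a" for i
  proof (rule ccontr)
    assume "\<not> ?thesis"
    then have one: "len (?A i) = len (?A (Suc i)) + 1"
      using drop[of i] i by simp
    obtain j where j: "i = Suc j"
      using i by (cases i) auto
    have undo: "act (?A (Suc i)) (alt s t i) = ?A i"
      using w by simp
    \<comment> \<open>Read upwards, step \<open>i\<close> raises the length by 1, so
      \<open>desc_act_fixed\<close> carries the descent for the following letter over to
      \<open>?A i\<close>. That letter is also the preceding one, which was just used and cannot be
      a descent.\<close>
    have "desc (alt s t (Suc i)) (?A i)"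
      using desc_act_fixed[of "?A (Suc i)" "alt s t i" "alt s t (Suc i)"] down[of "Suc i"] i one w
      unfolding undo by simp
    moreover have "\<not> desc (alt s t j) (?A i)"
      using desc_act[of "?A j" "alt s t j"] down[of j] w i unfolding j by simp
    moreover have "alt s t (Suc i) = alt s t j"
      by (simp add: j alt_def)
    ultimately show False by simp
  qed
  have "i \<le> a \<Longrightarrow> len w \<le> len (?A i) + 2 * i" for i
  proof (induction i)
    case (Suc i)
    then have "len w \<le> len (?A i) + 2 * i"
      by simp
    then show ?case
      using drop[of i] Suc.prems by (auto simp del: chain.simps)
  qed simp
  \<comment> \<open>The conditional is the slack: 1 for a short first step and 1 more for a short
    last step.\<close>
  moreover have "i \<le> a \<Longrightarrow> len (?A i) + 2 * i \<le> len w + (if i = 0 then 0 else if i < a then 1 else 2)" for i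
  proof (induction i)
    case (Suc i)
    define x y where "x = len (?A i)" and "y = len (?A (Suc i))"
    have i: "i < a"
      using Suc.prems by simp
    have IH: "x + 2 * i \<le> len w + (if i = 0 then 0 else 1)"
      using Suc.IH i by (simp add: x_def split: if_splits)
    have "y + 1 \<le> x"
      using drop[OF i] unfolding x_def y_def by linarith
    moreover have "y + 2 = x" if "0 < i" "Suc i < a"
      using drop2[OF that] unfolding x_def y_def by linarith
    ultimately have "y + 2 * Suc i \<le> len w + (if Suc i < a then 1 else 2)"
      using IH i by (cases "i = 0"; cases "Suc i < a") simp_all
    then show ?case
      unfolding y_def by simp
  qed simp
  ultimately have "len w \<le> len (?A a) + 2 * a" "len (?A a) + 2 * a \<le> len w + 2"
    using \<open>a > 0\<close> by (blast, fastforce)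
  then show ?thesis
    using that[OF \<open>a > 0\<close> down min] by blast
qed

text \<open>The number of steps of a descending path to the identity, kept as a relation until
  \<open>rk_unique\<close> shows independence of the path and \<open>tw_rank_rk\<close> identifies
  it with \<open>tw_rank\<close>.\<close>

inductive rk :: "'a \<Rightarrow> nat \<Rightarrow> bool" where
  one: "rk \<one> 0"
| up: "w \<in> I \<Longrightarrow> s \<in> S \<Longrightarrow> desc s w \<Longrightarrow> rk (act w s) k \<Longrightarrow> rk w (Suc k)"

lemma rk_one: "rk \<one> k \<Longrightarrow> k = 0"
  by (erule rk.cases) (use no_desc_one in blast)+

lemma rk_desc:
  assumes "rk w k" "w \<noteq> \<one>"
  obtains s l where "s \<in> S" "desc s w" "rk (act w s) l" "k = Suc l"
  using assms(1)
proof (cases rule: rk.cases)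
  case one
  then show ?thesis using assms by blast
next
  case (up s l)
  then show ?thesis using that by blast
qed

lemma rk_exists: "w \<in> I \<Longrightarrow> \<exists>k. rk w k"
proof (induction "len w" arbitrary: w rule: less_induct)
  case less
  show ?case
  proof (cases "w = \<one>")
    case False
    then obtain s where "s \<in> S" "desc s w"
      using ex_desc less.prems by blast
    then show ?thesis
      using less.hyps[of "act w s"] less.prems desc_iff by (meson act_closed rk.up)
  qed (use rk.one in blast)
qed

lemma rk_chain:
  assumes w: "w \<in> I" "s \<in> S" "t \<in> S" and down: "\<And>i. i < a \<Longrightarrow> desc (alt s t i) (chain w s t i)"
    and k: "rk (chain w s t a) k"
  shows "j \<le> a \<Longrightarrow> rk (chain w s t (a - j)) (k + j)"
proof (induction j)
  case (Suc j)
  let ?i = "a - Suc j"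
  have "a - j = Suc ?i"
    using Suc.prems by simp
  then have "rk (act (chain w s t ?i) (alt s t ?i)) (k + j)"
    using Suc by simp
  then have "rk (chain w s t ?i) (Suc (k + j))"
    using rk.up[of "chain w s t ?i" "alt s t ?i"] down[of ?i] Suc.prems w by simp
  then show ?case by simp
qed (use k in simp)

text \<open>The length bounds of \<open>chain_bottom\<close> leave a difference of at most 1 between
  two chains with the same ends; \<open>chain_shift\<close> removes it.\<close>

lemma chain_lengths_le:
  assumes w: "w \<in> I" "s \<in> S" "t \<in> S"
    and eq: "chain w s t a = chain w t s b"
    and "b \<le> Suc a"
  shows "b \<le> a"
proof (rule ccontr)
  assume "\<not> b \<le> a"
  then have "b = Suc a"
    using assms by simp
  then have "act w t = w"
    using chain_shift[OF w, of a] eq by (simp only:)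
  then show False
    using act_neq[of w t] w by simp
qed

text \<open>Two first descents \<open>s\<close> and \<open>t\<close> extend to chains with a common
  bottom \<open>?u\<close> and equal length \<open>a\<close>. By induction both successors of
  \<open>w\<close> have the value of \<open>?u\<close> plus \<open>a - 1\<close>. The case
  \<open>s = t\<close> is covered, with chains of one step.\<close>

lemma rk_unique: "w \<in> I \<Longrightarrow> rk w k \<Longrightarrow> rk w l \<Longrightarrow> k = l"
proof (induction "len w" arbitrary: w k l rule: less_induct)
  case less
  show ?case
  proof (cases "w = \<one>")
    case True
    then show ?thesis
      using less.prems rk_one by blast
  next
    case False
    obtain s k' where s: "s \<in> S" "desc s w" "rk (act w s) k'" "k = Suc k'"
      using rk_desc[OF less.prems(2) False] by blast
    obtain t l' where t: "t \<in> S" "desc t w" "rk (act w t) l'" "l = Suc l'"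
      using rk_desc[OF less.prems(3) False] by blast
    note w = less.prems(1)
    obtain a where a: "a > 0" "\<And>i. i < a \<Longrightarrow> desc (alt s t i) (chain w s t i)"
      "\<not> desc s (chain w s t a)" "\<not> desc t (chain w s t a)"
      "len w \<le> len (chain w s t a) + 2 * a" "len (chain w s t a) + 2 * a \<le> len w + 2"
      using chain_bottom[OF w s(1) t(1) s(2) t(2)] by blast
    obtain b where b: "b > 0" "\<And>i. i < b \<Longrightarrow> desc (alt t s i) (chain w t s i)"
      "\<not> desc t (chain w t s b)" "\<not> desc s (chain w t s b)"
      "len w \<le> len (chain w t s b) + 2 * b" "len (chain w t s b) + 2 * b \<le> len w + 2"
      using chain_bottom[OF w t(1) s(1) t(2) s(2)] by blast
    let ?u = "chain w s t a"
    have J: "{s, t} \<subseteq> S"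
      using s t by simp
    have "(w, ?u) \<in> (steps {s, t})\<^sup>*" "(w, chain w t s b) \<in> (steps {s, t})\<^sup>*"
      using chain_steps[OF w s(1) t(1)] chain_steps[OF w t(1) s(1)] by (simp_all add: insert_commute)
    then have "(?u, chain w t s b) \<in> (steps {s, t})\<^sup>*"
      using sym_steps[OF J] by (meson rtrancl_trans symD)
    then have eq: "?u = chain w t s b"
      using component_min_unique[OF _ _ J, of ?u "chain w t s b"] w s t a b by auto
    have "b \<le> a" "a \<le> b"
      using chain_lengths_le[OF w s(1) t(1) eq] chain_lengths_le[OF w t(1) s(1) eq[symmetric]] a b eq
      by auto
    then have ab: "b = a" by simp
    obtain m where m: "rk ?u m"
      using rk_exists[of ?u] w s t by auto
    \<comment> \<open>The index \<open>a - (a - 1)\<close> is 1, the position just after the first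
      step.\<close>
    have "rk (chain w s t (a - (a - 1))) (m + (a - 1))"
      using rk_chain[OF w s(1) t(1) a(2) m] by simp
    then have "rk (act w s) (m + (a - 1))"
      using a(1) by (simp add: alt_def)
    then have "k' = m + (a - 1)"
      using less.hyps[of "act w s"] s w desc_iff by auto
    moreover have "rk (chain w t s (a - (a - 1))) (m + (a - 1))"
      using rk_chain[OF w t(1) s(1) b(2), of b m "a - 1"] m eq ab by simp
    then have "rk (act w t) (m + (a - 1))"
      using a(1) by (simp add: alt_def)
    then have "l' = m + (a - 1)"
      using less.hyps[of "act w t"] t w desc_iff by auto
    ultimately show ?thesis
      using s t by simp
  qed
qed

lemma tw_act_word_simps [simp]:
  "tw_act_word G \<theta> w [] = w"
  "tw_act_word G \<theta> w (p @ q) = tw_act_word G \<theta> (tw_act_word G \<theta> w p) q"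
  "tw_act_word G \<theta> w [s] = act w s"
  by (simp_all add: tw_act_word_def)

lemma tw_act_word_tw: "w \<in> I \<Longrightarrow> p \<in> lists S \<Longrightarrow> tw_act_word G \<theta> w p \<in> I"
  by (induction p rule: rev_induct) simp_all

lemma rk_word: "rk w k \<Longrightarrow> \<exists>p\<in>lists S. length p = k \<and> tw_act_word G \<theta> \<one> p = w"
proof (induction rule: rk.induct)
  case one
  show ?case by (rule bexI[of _ "[]"]) simp_all
next
  case (up w s k)
  then obtain p where "p \<in> lists S" "length p = k" "tw_act_word G \<theta> \<one> p = act w s"
    by blast
  then show ?case
    using up.hyps by (intro bexI[of _ "p @ [s]"]) simp_all
qed

text \<open>By uniqueness each letter of any word changes \<open>rk\<close> by exactly 1, up or down
  according to \<open>desc\<close>, so no word beats a descending path.\<close>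

lemma rk_le_length: "p \<in> lists S \<Longrightarrow> rk (tw_act_word G \<theta> \<one> p) k \<Longrightarrow> k \<le> length p"
proof (induction p arbitrary: k rule: rev_induct)
  case Nil
  then show ?case
    using rk_one by simp
next
  case (snoc s p)
  let ?v = "tw_act_word G \<theta> \<one> p"
  have S: "p \<in> lists S" "s \<in> S" and v: "?v \<in> I"
    using snoc.prems by (auto simp: tw_act_word_tw)
  have k: "rk (act ?v s) k"
    using snoc.prems by simp
  show ?case
  proof (cases "desc s ?v")
    case True
    then have "rk ?v (Suc k)"
      using rk.up v S k by blast
    then show ?thesis
      using snoc.IH[OF S(1)] by force
  next
    case False
    obtain l where l: "rk ?v l"
      using rk_exists v by blast
    have "rk (act ?v s) (Suc l)"
      using rk.up[of "act ?v s" s l] l v S False desc_act by simp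
    then have "k = Suc l"
      using rk_unique[of "act ?v s"] k v S by simp
    then show ?thesis
      using snoc.IH[OF S(1) l] by simp
  qed
qed

lemma tw_rank_rk:
  assumes "rk w k" shows "tw_rank G S \<theta> w = k"
  unfolding tw_rank_def
proof (rule Least_equality)
  show "\<exists>p\<in>lists S. length p = k \<and> tw_act_word G \<theta> \<one> p = w"
    using rk_word[OF assms] .
qed (use rk_le_length assms in blast)

lemma tw_rank_desc:
  assumes "w \<in> I" "s \<in> S" "desc s w"
  shows "tw_rank G S \<theta> w = Suc (tw_rank G S \<theta> (act w s))"
  using rk_exists[of "act w s"] rk.up[of w s] tw_rank_rk assms by (metis act_closed)

subsection \<open>Components and the weak order\<close>

lemma weak_le_refl: "w \<in> I \<Longrightarrow> weak_le G S \<theta> w w"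
  unfolding weak_le_def by (intro conjI bexI[of _ "[]"]) simp_all

lemma weak_le_trans:
  assumes "weak_le G S \<theta> u v" "weak_le G S \<theta> v w" shows "weak_le G S \<theta> u w"
proof -
  obtain p q where "p \<in> lists S" "q \<in> lists S" "tw_act_word G \<theta> u p = v" "tw_act_word G \<theta> v q = w"
    "int (tw_rank G S \<theta> u) = int (tw_rank G S \<theta> v) - int (length p)"
    "int (tw_rank G S \<theta> v) = int (tw_rank G S \<theta> w) - int (length q)"
    using assms unfolding weak_le_def by blast
  then have "p @ q \<in> lists S \<and> tw_act_word G \<theta> u (p @ q) = w \<and>
      int (tw_rank G S \<theta> u) = int (tw_rank G S \<theta> w) - int (length (p @ q))"
    by simp
  then show ?thesis
    using assms unfolding weak_le_def by blast
qed

lemma weak_le_act: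
  assumes "w \<in> I" "s \<in> S" "desc s w" shows "weak_le G S \<theta> (act w s) w"
  unfolding weak_le_def
  using assms tw_rank_desc[OF assms] by (intro conjI bexI[of _ "[s]"]) simp_all

text \<open>Descending from \<open>v\<close> along letters of \<open>J\<close> stays in the
  component and follows the weak order; by \<open>component_min_unique\<close> the descent can only
  end in \<open>u\<close>.\<close>

lemma component_min_weak_le:
  assumes "u \<in> I" "J \<subseteq> S" "\<And>s. s \<in> J \<Longrightarrow> \<not> desc s u" "(u, v) \<in> (steps J)\<^sup>*"
  shows "weak_le G S \<theta> u v"
  using assms(4)
proof (induction "len v" arbitrary: v rule: less_induct)
  case less
  have v: "v \<in> I"
    using steps_tw less.prems assms by blast
  show ?case
  proof (cases "\<exists>s\<in>J. desc s v")
    case True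
    then obtain s where s: "s \<in> J" "s \<in> S" "desc s v"
      using assms by blast
    have "(v, act v s) \<in> steps J"
      using stepsI v s by blast
    then have "weak_le G S \<theta> u (act v s)"
      using less s v desc_iff by (meson rtrancl.rtrancl_into_rtrancl)
    then show ?thesis
      using weak_le_trans weak_le_act[OF v s(2,3)] by blast
  next
    case False
    then have "u = v"
      using component_min_unique[OF less.prems] assms by blast
    then show ?thesis
      using weak_le_refl v by simp
  qed
qed

text \<open>Makes the component for \<open>J = S\<close> the whole graph, which serves as the empty
  cell.\<close>

lemma connected: "w \<in> I \<Longrightarrow> (\<one>, w) \<in> (steps S)\<^sup>*"
proof (induction "len w" arbitrary: w rule: less_induct)
  case less
  show ?case
  proof (cases "w = \<one>")
    case False
    then obtain s where s: "s \<in> S" "desc s w"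
      using ex_desc less.prems by blast
    have "(act w s, act (act w s) s) \<in> steps S"
      using s less.prems by (intro stepsI) simp_all
    then show ?thesis
      using less s desc_iff by (metis act_act act_closed rtrancl.rtrancl_into_rtrancl)
  qed simp
qed

end

section \<open>The cell complex\<close>

text \<open>Passing to a down-set changes no lower interval, hence neither the 0-cells nor the
  dimension of a cell. In \<open>shelling_order\<close> the dimension of a facet of an intersection
  is measured inside that intersection, and this transfers it to the complex.\<close>

lemma cell_dim_downset:
  assumes "Q \<subseteq> P" "\<And>c. c \<in> Q \<Longrightarrow> closed_cell P leq c \<subseteq> Q" "c \<in> Q"
  shows "cell_dim Q leq c = cell_dim P leq c"
proof -
  have "closed_cell Q leq x = closed_cell P leq x" if "x \<in> Q" for x
    using assms(1,2) that by (force simp: closed_cell_def)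
  then have "closed_cell Q leq c = closed_cell P leq c" "vertices Q leq = vertices P leq \<inter> Q"
    using assms(1,3) by (auto simp: vertices_def)
  moreover have "closed_cell P leq c \<subseteq> Q"
    using assms(2,3) by blast
  ultimately show ?thesis
    unfolding cell_dim_def by (metis Int_absorb2 inf_assoc inf_commute)
qed

locale finite_twisted_coxeter = twisted_coxeter +
  assumes finite_carrier: "finite (carrier G)"
begin

abbreviation (input) P where "P \<equiv> Delta_cells G S \<theta>"
abbreviation (input) cell where "cell \<equiv> coset_cell G S \<theta>"
abbreviation (input) comp where "comp J w \<equiv> (steps J)\<^sup>* `` {w}"

lemma finite_gens [simp]: "finite S"
  using finite_subset[OF _ finite_carrier] gens_closed by blast

lemma finite_tw: "finite I"
  using finite_subset[OF _ finite_carrier] tw_carrier by blast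

section \<open>Cells as components and their containment\<close>

lemma tw_graph_edges:
  assumes "J \<subseteq> S"
  shows "(e, s) \<in> snd (keep_labels (tw_graph G S \<theta>) J) \<longleftrightarrow> s \<in> J \<and> (\<exists>x\<in>I. e = {x, act x s})"
proof -
  have "act x s \<in> I" if "x \<in> I" "s \<in> J" for x s
    using that assms by auto
  then show ?thesis
    using assms unfolding keep_labels_def tw_graph_def by auto
qed

text \<open>Edges are unordered, but \<open>act_act\<close> makes both orientations steps, so
  reachability is given by \<open>steps\<close>. Since steps do not leave the component, every edge
  starting in it lies inside.\<close>

lemma coset_cell_eq:
  assumes J: "J \<subseteq> S" and w: "w \<in> I"
  shows "cell J w = (comp J w, {({x, act x s}, s) | x s. x \<in> comp J w \<and> s \<in> J})"
proof -
  let ?E = "snd (keep_labels (tw_graph G S \<theta>) J)"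
  have "({x, y}, s) \<in> ?E \<longleftrightarrow> s \<in> J \<and> x \<in> I \<and> y = act x s" for x y s
  proof
    assume "({x, y}, s) \<in> ?E"
    then obtain z where z: "s \<in> J" "z \<in> I" "{x, y} = {z, act z s}"
      unfolding tw_graph_edges[OF J] by blast
    then consider "x = z" "y = act z s" | "x = act z s" "y = z"
      by (auto simp: doubleton_eq_iff)
    then show "s \<in> J \<and> x \<in> I \<and> y = act x s"
      using z J by cases auto
  next
    assume "s \<in> J \<and> x \<in> I \<and> y = act x s"
    then show "({x, y}, s) \<in> ?E"
      unfolding tw_graph_edges[OF J] by blast
  qed
  then have rel: "{(x, y). \<exists>s. ({x, y}, s) \<in> ?E} = steps J"
    unfolding steps_def by blast
  have "comp J w \<subseteq> I"
    using steps_tw[OF _ w J] by blast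
  moreover from this have "act x s \<in> comp J w" if "x \<in> comp J w" "s \<in> J" for x s
    using that stepsI[of x s J] by (meson Image_singleton_iff rtrancl.rtrancl_into_rtrancl subsetD)
  ultimately have "{(e, s) \<in> ?E. e \<subseteq> comp J w} = {({x, act x s}, s) | x s. x \<in> comp J w \<and> s \<in> J}"
    unfolding tw_graph_edges[OF J] by blast
  moreover have "{v. (w, v) \<in> (steps J)\<^sup>*} = comp J w"
    by blast
  ultimately show ?thesis
    unfolding coset_cell_def component_def Let_def rel by simp
qed

lemma cellI: "J \<subseteq> S \<Longrightarrow> w \<in> I \<Longrightarrow> cell J w \<in> P"
  unfolding Delta_cells_def by blast

lemma steps_mono: "J \<subseteq> K \<Longrightarrow> (steps J)\<^sup>* \<subseteq> (steps K)\<^sup>*"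
  by (rule rtrancl_mono) (auto simp: steps_def)

text \<open>Every vertex of \<open>cell J w\<close> carries an edge for each label in
  \<open>J\<close>, so the edges at \<open>w\<close> alone force these labels to occur in
  \<open>K\<close>.\<close>

lemma Delta_le_iff:
  assumes J: "J \<subseteq> S" and K: "K \<subseteq> S" and w: "w \<in> I" and v: "v \<in> I"
  shows "Delta_le (cell K v) (cell J w) \<longleftrightarrow> J \<subseteq> K \<and> w \<in> comp K v"
proof
  assume "Delta_le (cell K v) (cell J w)"
  then have sub: "comp J w \<subseteq> comp K v"
    "{({x, act x s}, s) | x s. x \<in> comp J w \<and> s \<in> J} \<subseteq> {({x, act x s}, s) | x s. x \<in> comp K v \<and> s \<in> K}"
    unfolding Delta_le_def subgraph_def coset_cell_eq[OF J w] coset_cell_eq[OF K v] fst_conv snd_conv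
    by blast+
  have "w \<in> comp J w"
    by simp
  then show "J \<subseteq> K \<and> w \<in> comp K v"
    using sub by blast
next
  assume *: "J \<subseteq> K \<and> w \<in> comp K v"
  then have sub: "comp J w \<subseteq> comp K v"
    using steps_mono[of J K] by (auto intro: rtrancl_trans)
  show "Delta_le (cell K v) (cell J w)"
    unfolding Delta_le_def subgraph_def coset_cell_eq[OF J w] coset_cell_eq[OF K v] fst_conv snd_conv
    using sub * by blast
qed

lemma Delta_le_refl: "Delta_le c c"
  by (simp add: Delta_le_def subgraph_def)

lemma Delta_le_trans: "Delta_le c d \<Longrightarrow> Delta_le d e \<Longrightarrow> Delta_le c e"
  by (auto simp: Delta_le_def subgraph_def)

lemma Delta_le_antisym: "Delta_le c d \<Longrightarrow> Delta_le d c \<Longrightarrow> c = d"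
  by (auto simp: Delta_le_def subgraph_def prod_eq_iff)

lemma cell_cong:
  assumes "J \<subseteq> S" "v \<in> I" "w \<in> comp J v"
  shows "cell J v = cell J w"
proof -
  have "w \<in> I"
    using assms steps_tw by blast
  moreover have "v \<in> comp J w"
    using assms sym_steps[of J] by (auto dest: symD)
  ultimately show ?thesis
    using assms by (intro Delta_le_antisym) (simp_all add: Delta_le_iff)
qed

text \<open>The cells below \<open>cell J w\<close> are the components of \<open>w\<close> for
  larger label sets; complementing the label set turns reverse inclusion of graphs into inclusion of
  sets.\<close>

lemma closed_cell_eq:
  assumes J: "J \<subseteq> S" and w: "w \<in> I"
  shows "closed_cell P Delta_le (cell J w) = (\<lambda>K. cell (S - K) w) ` Pow (S - J)"
proof (intro equalityI subsetI)
  fix c assume "c \<in> closed_cell P Delta_le (cell J w)"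
  then obtain K v where Kv: "K \<subseteq> S" "v \<in> I" "c = cell K v" "J \<subseteq> K" "w \<in> comp K v"
    using Delta_le_iff assms by (auto simp: closed_cell_def Delta_cells_def)
  have "c = cell (S - (S - K)) w"
    using cell_cong[of K v w] Kv by (simp add: double_diff)
  then show "c \<in> (\<lambda>K. cell (S - K) w) ` Pow (S - J)"
    using Kv by blast
next
  fix c assume "c \<in> (\<lambda>K. cell (S - K) w) ` Pow (S - J)"
  then obtain K where K: "K \<subseteq> S - J" "c = cell (S - K) w"
    by blast
  then have "Delta_le c (cell J w)"
    using Delta_le_iff[of J "S - K" w w] assms by auto
  then show "c \<in> closed_cell P Delta_le (cell J w)"
    using K w by (auto simp: closed_cell_def Delta_cells_def)
qed

lemma Delta_le_compl:
  assumes "K \<subseteq> S" "L \<subseteq> S" "w \<in> I"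
  shows "Delta_le (cell (S - K) w) (cell (S - L) w) \<longleftrightarrow> K \<subseteq> L"
  using Delta_le_iff[of "S - L" "S - K" w w] assms by auto

lemma closed_cell_bij:
  assumes "J \<subseteq> S" "w \<in> I"
  shows "bij_betw (\<lambda>K. cell (S - K) w) (Pow (S - J)) (closed_cell P Delta_le (cell J w))"
  unfolding bij_betw_def closed_cell_eq[OF assms]
proof (intro conjI inj_onI)
  fix K L assume KL: "K \<in> Pow (S - J)" "L \<in> Pow (S - J)" "cell (S - K) w = cell (S - L) w"
  then have "Delta_le (cell (S - K) w) (cell (S - L) w)" "Delta_le (cell (S - L) w) (cell (S - K) w)"
    by (simp_all add: Delta_le_refl)
  then show "K = L"
    using Delta_le_compl[of K L w] Delta_le_compl[of L K w] KL assms by blast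
qed simp

section \<open>The Boolean complex: intervals, dimensions and facets\<close>

lemma finite_cells: "finite P"
proof -
  have "P = (\<lambda>(J, w). cell J w) ` (Pow S \<times> I)"
    by (auto simp: Delta_cells_def)
  then show ?thesis
    using finite_tw by simp
qed

lemma boolean_cell_complex_Delta: "boolean_cell_complex P Delta_le"
  unfolding boolean_cell_complex_def
proof (intro conjI)
  show "finite P" by (rule finite_cells)
  show "reflp_on P Delta_le" by (auto intro: reflp_onI Delta_le_refl)
  show "antisymp_on P Delta_le" by (auto intro: antisymp_onI Delta_le_antisym)
  show "transp_on P Delta_le" by (auto intro: transp_onI Delta_le_trans)
  show "\<exists>b\<in>P. \<forall>c\<in>P. Delta_le b c"
  proof
    \<comment> \<open>By \<open>connected\<close> this is the whole graph, the empty cell.\<close>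
    show "cell S \<one> \<in> P"
      by (rule cellI) simp_all
    show "\<forall>c\<in>P. Delta_le (cell S \<one>) c"
      using Delta_le_iff connected by (auto simp: Delta_cells_def)
  qed
  show "\<forall>c\<in>P. \<exists>(n::nat) f. bij_betw f (closed_cell P Delta_le c) (Pow {..<n}) \<and>
    (\<forall>x\<in>closed_cell P Delta_le c. \<forall>y\<in>closed_cell P Delta_le c. Delta_le x y \<longleftrightarrow> f x \<subseteq> f y)"
  proof
    fix c assume "c \<in> P"
    then obtain J w where Jw: "J \<subseteq> S" "w \<in> I" "c = cell J w"
      by (auto simp: Delta_cells_def)
    let ?C = "closed_cell P Delta_le c" and ?g = "\<lambda>K. cell (S - K) w"
    \<comment> \<open>\<open>?f\<close> recovers the complementary label set of a cell; the
      bijection \<open>h\<close> below renumbers the labels in \<open>S - J\<close> by an initial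
      segment.\<close>
    let ?f = "the_inv_into (Pow (S - J)) ?g"
    have g: "bij_betw ?g (Pow (S - J)) ?C"
      using closed_cell_bij Jw by simp
    then have f: "bij_betw ?f ?C (Pow (S - J))"
      by (rule bij_betw_the_inv_into)
    obtain h where h: "bij_betw h (S - J) {..<card (S - J)}"
      using ex_bij_betw_finite_nat[of "S - J"] by (auto simp: atLeast0LessThan)
    have "bij_betw (\<lambda>x. h ` ?f x) ?C (Pow {..<card (S - J)})"
      using bij_betw_trans[OF f bij_betw_Pow[OF h]] by (simp add: o_def)
    moreover have "Delta_le x y \<longleftrightarrow> h ` ?f x \<subseteq> h ` ?f y" if "x \<in> ?C" "y \<in> ?C" for x y
    proof -
      have mem: "?f x \<subseteq> S - J" "?f y \<subseteq> S - J" and "?g (?f x) = x" "?g (?f y) = y"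
        using that f g f_the_inv_into_f_bij_betw[OF g] by (auto simp: bij_betw_def)
      then have "Delta_le x y \<longleftrightarrow> ?f x \<subseteq> ?f y"
        using Delta_le_compl[of "?f x" "?f y" w] Jw(2) by auto
      moreover have "h a \<in> h ` ?f y \<longleftrightarrow> a \<in> ?f y" if "a \<in> ?f x" for a
        using inj_on_image_mem_iff[of h "S - J" a "?f y"] h that mem by (auto simp: bij_betw_def)
      ultimately show ?thesis
        by blast
    qed
    ultimately show "\<exists>(n::nat) f. bij_betw f ?C (Pow {..<n}) \<and>
        (\<forall>x\<in>?C. \<forall>y\<in>?C. Delta_le x y \<longleftrightarrow> f x \<subseteq> f y)"
      by (intro exI[of _ "card (S - J)"] exI[of _ "\<lambda>x. h ` ?f x"] conjI ballI) simp_all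
  qed
qed

lemma cell_in_vertices_iff:
  assumes "J \<subseteq> S" "w \<in> I"
  shows "cell J w \<in> vertices P Delta_le \<longleftrightarrow> card (S - J) = 1"
proof -
  have "card (closed_cell P Delta_le (cell J w)) = 2 ^ card (S - J)"
    using bij_betw_same_card[OF closed_cell_bij[OF assms]] by (simp add: card_Pow)
  moreover have "cell J w \<in> P"
    using assms by (auto simp: Delta_cells_def)
  moreover have "(2::nat) ^ n = 2 \<longleftrightarrow> n = 1" for n
    using power_inject_exp[of "2::nat" n 1] by simp
  ultimately show ?thesis
    by (simp add: vertices_def)
qed

text \<open>The 0-cells below \<open>cell J w\<close> correspond to the singletons in
  \<open>S - J\<close>, one for each missing label.\<close>

lemma cell_dim_eq:
  assumes "J \<subseteq> S" "w \<in> I"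
  shows "cell_dim P Delta_le (cell J w) = int (card (S - J)) - 1"
proof -
  let ?g = "\<lambda>K. cell (S - K) w"
  have v: "?g K \<in> vertices P Delta_le \<longleftrightarrow> card K = 1" if "K \<subseteq> S - J" for K
    using cell_in_vertices_iff[of "S - K" w] assms that by (simp add: double_diff subset_trans[OF that])
  have "closed_cell P Delta_le (cell J w) \<inter> vertices P Delta_le = ?g ` {K \<in> Pow (S - J). card K = 1}"
    unfolding closed_cell_eq[OF assms] using v by blast
  moreover have "inj_on ?g {K \<in> Pow (S - J). card K = 1}"
    using closed_cell_bij[OF assms] by (auto simp: bij_betw_def intro: inj_on_subset)
  moreover have "card {K \<in> Pow (S - J). card K = 1} = card (S - J)"
    using n_subsets[of "S - J" 1] by simp
  ultimately show ?thesis
    by (simp add: cell_dim_def card_image)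
qed

lemma facets_Delta: "facets P Delta_le = cell {} ` I"
proof (intro equalityI subsetI)
  fix c assume c: "c \<in> facets P Delta_le"
  then obtain J w where Jw: "J \<subseteq> S" "w \<in> I" "c = cell J w"
    by (auto simp: facets_def Delta_cells_def)
  have "cell {} w \<in> P" "Delta_le c (cell {} w)"
    using Jw by (auto simp: Delta_cells_def Delta_le_iff)
  then show "c \<in> cell {} ` I"
    using c Jw(2) by (auto simp: facets_def)
next
  fix c assume "c \<in> cell {} ` I"
  then obtain w where w: "w \<in> I" "c = cell {} w"
    by blast
  have "d = c" if d: "d \<in> P" "Delta_le c d" for d
  proof -
    obtain J v where Jv: "J \<subseteq> S" "v \<in> I" "d = cell J v"
      using d(1) by (auto simp: Delta_cells_def)
    then have "J = {}" "v \<in> comp {} w"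
      using d(2) Delta_le_iff[of J "{}" v w] w by auto
    then show ?thesis
      using cell_cong[of "{}" w v] w Jv by simp
  qed
  then show "c \<in> facets P Delta_le"
    using w by (auto simp: facets_def Delta_cells_def)
qed

lemma inj_on_facets: "inj_on (cell {}) I"
proof (rule inj_onI)
  fix v w assume vw: "v \<in> I" "w \<in> I" "cell {} v = cell {} w"
  then have "Delta_le (cell {} v) (cell {} w)"
    by (simp add: Delta_le_refl)
  then have "w \<in> comp {} v"
    using vw Delta_le_iff[of "{}" "{}" w v] by simp
  moreover have "steps {} = {}"
    by (simp add: steps_def)
  ultimately show "v = w"
    by simp
qed

section \<open>Shelling along the weak order\<close>

lemma linear_extension_shelling:
  assumes ws: "linear_extension I (weak_le G S \<theta>) ws"
  shows "shelling_order P Delta_le (map (cell {}) ws)"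
proof -
  have dist: "distinct ws" and set: "set ws = I"
    and ext: "\<And>i j. i < length ws \<Longrightarrow> j < length ws \<Longrightarrow> weak_le G S \<theta> (ws ! i) (ws ! j) \<Longrightarrow> i \<le> j"
    using ws by (auto simp: linear_extension_def)
  have pure: "pure_of_dim P Delta_le (int (card S) - 1)"
    unfolding pure_of_dim_def facets_Delta by (auto simp: cell_dim_eq)
  have step: "pure_of_dim (closed_cell P Delta_le (map (cell {}) ws ! i) \<inter>
      (\<Union>\<alpha><i. closed_cell P Delta_le (map (cell {}) ws ! \<alpha>))) Delta_le
      (cell_dim P Delta_le (map (cell {}) ws ! i) - 1)"
    if i: "i < length ws" for i
  proof -
    let ?w = "ws ! i"
    let ?Q = "closed_cell P Delta_le (cell {} ?w) \<inter> (\<Union>\<alpha><i. closed_cell P Delta_le (cell {} (ws ! \<alpha>)))"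
    have w: "?w \<in> I"
      using i set nth_mem by blast
    have Q: "(\<Union>\<alpha><i. closed_cell P Delta_le (map (cell {}) ws ! \<alpha>)) =
        (\<Union>\<alpha><i. closed_cell P Delta_le (cell {} (ws ! \<alpha>)))"
      using i by auto
    \<comment> \<open>Every maximal cell \<open>F\<close> of the intersection will turn out to be
      \<open>cell {s} ?w\<close> for some generator \<open>s\<close>.\<close>
    have "cell_dim ?Q Delta_le F = cell_dim P Delta_le (cell {} ?w) - 1" if F: "F \<in> facets ?Q Delta_le" for F
    proof -
      have FQ: "F \<in> ?Q" and max: "\<And>c. c \<in> ?Q \<Longrightarrow> Delta_le F c \<Longrightarrow> c = F"
        using F by (auto simp: facets_def)
      obtain J where J: "J \<subseteq> S" "F = cell J ?w"
        using FQ closed_cell_eq[of "{}" ?w] w by auto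
      obtain \<alpha> where \<alpha>: "\<alpha> < i" "Delta_le F (cell {} (ws ! \<alpha>))"
        using FQ by (auto simp: closed_cell_def)
      have v: "ws ! \<alpha> \<in> I"
        using \<alpha> i set nth_mem by (metis order.strict_trans)
      have conn: "(?w, ws ! \<alpha>) \<in> (steps J)\<^sup>*"
        using \<alpha>(2) Delta_le_iff[of "{}" J "ws ! \<alpha>" ?w] J v w by simp
      \<comment> \<open>Without a descent in \<open>J\<close>, \<open>?w\<close> would be the weak
        order minimum of a component containing the earlier \<open>ws ! \<alpha>\<close>, which a
        linear extension excludes.\<close>
      obtain s where s: "s \<in> J" "desc s ?w"
      proof (rule ccontr)
        assume "\<not> thesis"
        then have "weak_le G S \<theta> ?w (ws ! \<alpha>)"
          using component_min_weak_le[OF w J(1) _ conn] that by blast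
        then show False
          using ext[of i \<alpha>] i \<alpha>(1) by simp
      qed
      have sS: "s \<in> S"
        using s J by blast
      have actI: "act ?w s \<in> I"
        using w sS by simp
      \<comment> \<open>The neighbour \<open>act ?w s\<close> precedes \<open>?w\<close> in the
        list, and the facets of both contain the codimension one cell
        \<open>cell {s} ?w\<close>.\<close>
      then obtain \<beta> where \<beta>: "\<beta> < length ws" "ws ! \<beta> = act ?w s"
        using set by (metis in_set_conv_nth)
      have "\<beta> \<le> i"
        using ext[of \<beta> i] \<beta> i weak_le_act[OF w sS s(2)] by simp
      moreover have "\<beta> \<noteq> i"
        using \<beta> act_neq[OF w sS] by auto
      ultimately have "\<beta> < i" by simp
      have "(?w, act ?w s) \<in> (steps {s})\<^sup>*"
        using stepsI[of ?w s "{s}"] w by blast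
      then have "Delta_le (cell {s} ?w) (cell {} (ws ! \<beta>))" "Delta_le (cell {s} ?w) (cell {} ?w)"
        using Delta_le_iff[of "{}" "{s}" _ ?w] sS w actI \<beta> by simp_all
      moreover have "cell {s} ?w \<in> P"
        using sS w unfolding Delta_cells_def by blast
      ultimately have "cell {s} ?w \<in> ?Q"
        using \<open>\<beta> < i\<close> by (auto simp: closed_cell_def)
      moreover have "Delta_le F (cell {s} ?w)"
        unfolding J(2) using Delta_le_iff[of "{s}" J ?w ?w] s J sS w by simp
      ultimately have eq: "F = cell {s} ?w"
        using max by blast
      have "cell_dim ?Q Delta_le F = cell_dim P Delta_le F"
      proof (rule cell_dim_downset[OF _ _ FQ])
        show "?Q \<subseteq> P"
          by (auto simp: closed_cell_def)
        show "closed_cell P Delta_le c \<subseteq> ?Q" if "c \<in> ?Q" for c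
          using that unfolding closed_cell_def by (blast intro: Delta_le_trans)
      qed
      also have "\<dots> = int (card (S - {s})) - 1"
        unfolding eq using cell_dim_eq[of "{s}" ?w] sS w by simp
      also have "\<dots> = cell_dim P Delta_le (cell {} ?w) - 1"
        using cell_dim_eq[of "{}" ?w] w card_Suc_Diff1[OF finite_gens sS] by simp
      finally show ?thesis .
    qed
    then show ?thesis
      unfolding Q pure_of_dim_def using i by simp
  qed
  show ?thesis
    unfolding shelling_order_def
  proof (intro conjI exI ballI)
    show "boolean_cell_complex P Delta_le"
      by (rule boolean_cell_complex_Delta)
    show "pure_of_dim P Delta_le (int (card S) - 1)"
      by (rule pure)
    show "distinct (map (cell {}) ws)"
      using dist set inj_on_facets by (simp add: distinct_map)
    show "set (map (cell {}) ws) = facets P Delta_le"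
      using set facets_Delta by simp
  qed (use step in simp)
qed

text \<open>Sorting by rank works because a weak order relation strictly increases the rank unless
  its word is empty.\<close>

lemma ex_linear_extension: "\<exists>ws. linear_extension I (weak_le G S \<theta>) ws"
proof -
  let ?r = "tw_rank G S \<theta>"
  obtain xs where xs: "set xs = I" "distinct xs"
    using finite_distinct_list[OF finite_tw] by blast
  define ws where "ws = sort_key ?r xs"
  have ws: "set ws = I" "distinct ws" and sorted: "sorted (map ?r ws)"
    using xs by (simp_all add: ws_def)
  have "i \<le> j" if ij: "i < length ws" "j < length ws" "weak_le G S \<theta> (ws ! i) (ws ! j)" for i j
  proof (rule ccontr)
    assume "\<not> i \<le> j"
    then have "?r (ws ! j) \<le> ?r (ws ! i)"
      using sorted_nth_mono[OF sorted, of j i] ij by simp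
    moreover obtain p where p: "tw_act_word G \<theta> (ws ! i) p = ws ! j"
      "int (?r (ws ! i)) = int (?r (ws ! j)) - int (length p)"
      using ij(3) unfolding weak_le_def by blast
    ultimately have "length p = 0"
      by linarith
    then have "i = j"
      using p(1) ws(2) ij(1,2) by (simp add: nth_eq_iff_index_eq)
    then show False
      using \<open>\<not> i \<le> j\<close> by simp
  qed
  then show ?thesis
    using ws unfolding linear_extension_def by blast
qed

end

theorem theorem5p7:
  fixes W :: "('a, 'b) monoid_scheme" and S :: "'a set" and \<theta> :: "'a \<Rightarrow> 'a"
  assumes "coxeter_system W S"
    and "finite (carrier W)"
    and "\<theta> \<in> iso W W"
    and "\<And>x. x \<in> carrier W \<Longrightarrow> \<theta> (\<theta> x) = x"
    and "\<theta> ` S = S"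
  shows "(\<forall>ws. linear_extension (twisted_involutions W \<theta>) (weak_le W S \<theta>) ws \<longrightarrow>
            shelling_order (Delta_cells W S \<theta>) Delta_le (map (coset_cell W S \<theta> {}) ws))
         \<and> shellable (Delta_cells W S \<theta>) Delta_le"
proof -
  have "group W"
    using assms(1) unfolding coxeter_system_def presented_by_def by blast
  then interpret group W .
  interpret finite_twisted_coxeter W S \<theta>
    by unfold_locales (use assms in auto)
  show ?thesis
    using linear_extension_shelling ex_linear_extension unfolding shellable_def by blast
qed

end
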